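(* $\mathrm{HNN}\not\subseteq\mathrm{MAJ}\circ\mathrm{MAJ}$. More precisely, there is a Boolean function with an HNN representation with $n+1$ anchors which cannot be computed by a depth-two majority circuit with $\mathrm{poly}(n)$ gates.
   Context: Let $\Delta(\mathbf{x},\mathbf{y})=\|\mathbf{x}-\mathbf{y}\|_2^2$. An HNN representation of $f:\{0,1\}^n\to\{0,1\}$ is a pair of disjoint sets $P,N\subseteq\{0,1\}^n$ (anchors) such that $f(\mathbf{x})=1$ if some $\mathbf{p}\in P$ has $\Delta(\mathbf{x},\mathbf{p})<\Delta(\mathbf{x},\mathbf{q})$ for all $\mathbf{q}\in N$, and $f(\mathbf{x})=0$ if some $\mathbf{q}\in N$ has $\Delta(\mathbf{x},\mathbf{q})<\Delta(\mathbf{x},\mathbf{p})$ for all $\mathbf{p}\in P$. $\mathrm{HNN}$ is the class of (families of) functions with HNN representations using polynomially (in $n$) many anchors. A majority gate is a threshold gate $\mathbf{1}[\langle\mathbf{w},\mathbf{z}\rangle\ge\theta]$ with integer weights and threshold bounded in absolute value by a polynomial in $n$. $\mathrm{MAJ}\circ\mathrm{MAJ}$ is the class of functions computed by polynomial-size depth-two circuits consisting of a majority gate whose inputs are outputs of majority gates, where the bottom gates take as inputs variables, their negations, or constants. *)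

theory Defs
  imports "HOL-Analysis.L2_Norm" "HOL-Computational_Algebra.Polynomial"
begin

text \<open>
  Points of the cube $\{0,1\}^n$ are Boolean lists of length \<open>n\<close>. A function on Boolean lists
  is the same thing as a family $(f_n)_n$ of functions $f_n : \{0,1\}^n \to \{0,1\}$, where $f_n$
  is the restriction to lists of length \<open>n\<close>. ``Polynomially bounded'' means bounded by the
  values of a polynomial with natural-number coefficients.
\<close>

type_synonym bool_family = "bool list \<Rightarrow> bool"

definition cube :: "nat \<Rightarrow> bool list set" where
  "cube n = {x. length x = n}"

text \<open>Squared Euclidean distance; only used for lists of equal length.\<close>

definition sq_dist :: "bool list \<Rightarrow> bool list \<Rightarrow> real" where
  "sq_dist x y = (L2_set (\<lambda>i. of_bool (x ! i) - of_bool (y ! i)) {..<length x})\<^sup>2"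

text \<open>
  The two conditions define the value of \<open>f\<close> at every point of the cube. In particular no point
  may be equally close to its nearest anchors in \<open>P\<close> and in \<open>N\<close>.
\<close>

definition HNN_rep :: "nat \<Rightarrow> bool_family \<Rightarrow> bool list set \<Rightarrow> bool list set \<Rightarrow> bool" where
  "HNN_rep n f P N \<longleftrightarrow>
     P \<subseteq> cube n \<and> N \<subseteq> cube n \<and> P \<inter> N = {} \<and>
     (\<forall>x\<in>cube n.
        (f x \<longleftrightarrow> (\<exists>p\<in>P. \<forall>q\<in>N. sq_dist x p < sq_dist x q)) \<and>
        (\<not> f x \<longleftrightarrow> (\<exists>q\<in>N. \<forall>p\<in>P. sq_dist x q < sq_dist x p)))"

definition HNN :: "bool_family set" where
  "HNN = {f. \<exists>r :: nat poly. \<forall>n. \<exists>P N. HNN_rep n f P N \<and> card (P \<union> N) \<le> poly r n}"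

datatype threshold_gate = Threshold_Gate (weights: "int list") (threshold: int)

definition gate_output :: "threshold_gate \<Rightarrow> bool list \<Rightarrow> bool" where
  "gate_output g z \<longleftrightarrow> (\<Sum>i<length z. weights g ! i * of_bool (z ! i)) \<ge> threshold g"

text \<open>A gate with \<open>m\<close> inputs whose weights and threshold are at most \<open>B\<close> in absolute value.
  Weight \<open>0\<close> means that the input is not connected.\<close>

definition bounded_gate :: "nat \<Rightarrow> nat \<Rightarrow> threshold_gate \<Rightarrow> bool" where
  "bounded_gate m B g \<longleftrightarrow>
     length (weights g) = m \<and> (\<forall>w\<in>set (weights g). \<bar>w\<bar> \<le> int B) \<and> \<bar>threshold g\<bar> \<le> int B"

text \<open>The variables, their negations and the two constants: \<open>2 * n + 2\<close> available inputs.\<close>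

definition bottom_inputs :: "bool list \<Rightarrow> bool list" where
  "bottom_inputs x = x @ map Not x @ [False, True]"

definition depth2_output :: "threshold_gate \<Rightarrow> threshold_gate list \<Rightarrow> bool list \<Rightarrow> bool" where
  "depth2_output t gs x = gate_output t (map (\<lambda>g. gate_output g (bottom_inputs x)) gs)"

text \<open>\<open>Suc (length gs)\<close> counts all gates, including the top gate.\<close>

definition MAJ_MAJ :: "bool_family set" where
  "MAJ_MAJ = {f. \<exists>s b :: nat poly. \<forall>n. \<exists>t gs.
     Suc (length gs) \<le> poly s n \<and>
     bounded_gate (length gs) (poly b n) t \<and>
     (\<forall>g\<in>set gs. bounded_gate (2 * n + 2) (poly b n) g) \<and>
     (\<forall>x\<in>cube n. f x \<longleftrightarrow> depth2_output t gs x)}"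

end

theory Submission
  imports Defs "HOL-Library.FuncSet" "HOL-Analysis.Convex" "HOL-Real_Asymp.Real_Asymp"
begin

text \<open>
  Read \<open>x \<in> {0,1}\<^sup>n\<close> as a walk on the integers that goes down at each 1 and up at each 0. The squared
  distance from \<open>x\<close> to the anchor \<open>1\<^sup>i 0\<^sup>n\<^sup>-\<^sup>i\<close> is the weight of \<open>x\<close> plus the height of the walk
  at time \<open>i\<close>. As the height at time \<open>i\<close> has the parity of \<open>i\<close>, labelling these \<open>n + 1\<close> anchors by the
  parity of \<open>i\<close> represents the parity of the minimum of the walk, and no ties occur.

  For the lower bound the bits are shared between two players. A block of steps reaches depth \<open>-c\<close>
  exactly if both players ask for it, and otherwise stays nonnegative. Hence the function computes the
  parity of the highest level \<open>l\<close> whose gadget fires, where a gadget is a disjunction of \<open>m\<close> bits of one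
  player, each selected by the other player out of \<open>b\<close> candidates. A depth-two majority circuit of
  polynomial size gives a function \<open>F\<close> of polynomial rectangle weight \<open>W\<close> whose sign is this parity.
  There is a signed measure on the gadget inputs that is nearly orthogonal to all rectangles, is a
  probability measure on the inputs that do not fire, and has positive mass at most 1/4 on those that
  fire. Since \<open>F\<close> changes sign when the next level fires, near orthogonality forces \<open>|F|\<close> to double from
  level to level, so \<open>2\<^sup>b \<le> W\<close> with \<open>b\<close> levels. The measure is a mixture of products of biased bits. Its
  weights annihilate the polynomials of degree at most \<open>2e\<close> in the bias, and this makes its
  discrepancy \<open>O(b\<^sup>-\<^sup>e)\<close>, where \<open>e\<close> may be chosen after the degree of \<open>W\<close>.
\<close>

subsection \<open>The parity of the minimum of a walk\<close>

definition walk :: "bool list \<Rightarrow> int" where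
  "walk xs = (\<Sum>x\<leftarrow>xs. if x then - 1 else 1)"

text \<open>The empty prefix is included, so the minimum over all prefixes is at most 0 even for a
  walk that stays positive.\<close>

fun walk_min :: "bool list \<Rightarrow> int" where
  "walk_min [] = 0"
| "walk_min (x # xs) = min 0 ((if x then - 1 else 1) + walk_min xs)"

lemma walk_simps [simp]:
  shows "walk [] = 0" and "walk (x # xs) = (if x then - 1 else 1) + walk xs"
    and "walk (xs @ ys) = walk xs + walk ys"
  by (simp_all add: walk_def)

lemma walk_min_nonpos: "walk_min xs \<le> 0"
  by (cases xs) auto

lemma walk_min_append: "walk_min (xs @ ys) = min (walk_min xs) (walk xs + walk_min ys)"
  by (induction xs) (use walk_min_nonpos[of ys] in auto)

lemma walk_min_le: "i \<le> length xs \<Longrightarrow> walk_min xs \<le> walk (take i xs)"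
proof (induction xs arbitrary: i)
  case (Cons x xs)
  then show ?case by (cases i) (auto simp: min_le_iff_disj)
qed simp

lemma walk_min_attained: "\<exists>i\<le>length xs. walk (take i xs) = walk_min xs"
proof (induction xs)
  case (Cons x xs)
  then obtain i where i: "i \<le> length xs" "walk (take i xs) = walk_min xs" by auto
  show ?case
  proof (cases "(if x then - 1 else 1) + walk_min xs \<le> 0")
    case True
    then show ?thesis using i by (intro exI[of _ "Suc i"]) auto
  next
    case False
    then show ?thesis by (intro exI[of _ 0]) auto
  qed
qed simp

lemma even_walk: "even (walk xs) \<longleftrightarrow> even (length xs)"
  by (induction xs) auto

definition walk_parity :: bool_family where
  "walk_parity x \<longleftrightarrow> even (walk_min x)"

definition step_point :: "nat \<Rightarrow> nat \<Rightarrow> bool list" where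
  "step_point n i = map (\<lambda>j. j < i) [0..<n]"

text \<open>For a bit \<open>a\<close> one has \<open>(a - 1)^2 = a + (1 - 2a)\<close>, and
  \<open>1 - 2a\<close> is the step of the walk. Coordinates from \<open>i\<close> on contribute
  \<open>a^2 = a\<close>.\<close>

lemma sq_dist_step_point:
  assumes "length x = n" "i \<le> n"
  shows "sq_dist x (step_point n i) = (\<Sum>j<n. of_bool (x ! j)) + of_int (walk (take i x))"
proof -
  have "sq_dist x (step_point n i) = (\<Sum>j<n. (of_bool (x ! j) - of_bool (j < i))\<^sup>2)"
    using assms by (simp add: sq_dist_def L2_set_def sum_nonneg step_point_def)
  also have "\<dots> = (\<Sum>j<n. of_bool (x ! j) + (if j < i then if x ! j then - 1 else 1 else 0))"
    by (intro sum.cong) auto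
  also have "\<dots> = (\<Sum>j<n. of_bool (x ! j)) + (\<Sum>j<i. if x ! j then - 1 else 1)"
  proof -
    have "{..<n} \<inter> {j. j < i} = {..<i}" using assms by auto
    then show ?thesis by (simp add: sum.distrib sum.If_cases)
  qed
  also have "(\<Sum>j<i. if x ! j then - 1 else 1) = real_of_int (walk (take i x))"
    using assms by (auto simp: walk_def sum_list_sum_nth lessThan_atLeast0 intro!: sum.cong)
  finally show ?thesis .
qed

lemma step_point_inj: "inj_on (step_point n) {..n}"
proof (rule inj_onI)
  fix i j assume "i \<in> {..n}" "j \<in> {..n}" and eq: "step_point n i = step_point n j"
  have "length (filter (\<lambda>a. a) (step_point n i)) = i" if "i \<le> n" for i
  proof -
    have "length (filter (\<lambda>a. a) (step_point n i)) = card {k. k < n \<and> k < i}"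
      by (simp add: step_point_def length_filter_conv_card cong: conj_cong)
    also have "{k. k < n \<and> k < i} = {..<i}" using that by auto
    finally show ?thesis by simp
  qed
  then show "i = j" using eq \<open>i \<in> _\<close> \<open>j \<in> _\<close> by (metis atMost_iff)
qed

lemma HNN_rep_walk_parity:
  "\<exists>P N. HNN_rep n walk_parity P N \<and> card (P \<union> N) = n + 1"
proof -
  define P where "P = step_point n ` {i\<in>{..n}. even i}"
  define N where "N = step_point n ` {i\<in>{..n}. odd i}"
  have PN: "P \<union> N = step_point n ` {..n}" by (auto simp: P_def N_def)
  have disj: "P \<inter> N = {}"
    using step_point_inj[of n] by (fastforce simp: P_def N_def dest: inj_onD)
  have main: "(walk_parity x \<longleftrightarrow> (\<exists>p\<in>P. \<forall>q\<in>N. sq_dist x p < sq_dist x q)) \<and>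
     (\<not> walk_parity x \<longleftrightarrow> (\<exists>q\<in>N. \<forall>p\<in>P. sq_dist x q < sq_dist x p))"
    if "x \<in> cube n" for x
  proof -
    have len: "length x = n" using that by (simp add: cube_def)
    define S where "S i = walk (take i x)" for i
    obtain i where i: "i \<le> n" "S i = walk_min x"
      using walk_min_attained[of x] len by (auto simp: S_def)
    have min: "S i \<le> S j" if "j \<le> n" for j
      using walk_min_le[of j x] that len i by (simp add: S_def)
    have par: "even (S j) \<longleftrightarrow> even j" if "j \<le> n" for j
      using that len by (simp add: S_def even_walk)
    have less: "sq_dist x (step_point n j) < sq_dist x (step_point n k) \<longleftrightarrow> S j < S k"
      if "j \<le> n" "k \<le> n" for j k
      using that len by (simp add: sq_dist_step_point S_def)
    \<comment> \<open>Heights at times of different parity have different parity, so they cannot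
      coincide.\<close>
    have strict: "S i < S j" if "j \<le> n" "even i \<noteq> even j" for j
      using min[OF that(1)] par[of i] par[of j] that i(1) by (metis order_le_less)
    \<comment> \<open>This rules out the opposite label: no anchor of the other class beats the
      anchor of time \<open>i\<close>.\<close>
    have nearest: "sq_dist x (step_point n i) \<le> sq_dist x (step_point n j)" if "j \<le> n" for j
      using min[OF that] less[OF that i(1)] by linarith
    have fi: "walk_parity x \<longleftrightarrow> even i"
      using par[OF i(1)] i(2) by (simp add: walk_parity_def)
    show ?thesis
    proof (cases "even i")
      case True
      have "\<exists>p\<in>P. \<forall>q\<in>N. sq_dist x p < sq_dist x q"
        using True i less strict by (auto simp: P_def N_def intro!: bexI[of _ i])
      moreover have "step_point n i \<in> P" using True i(1) by (simp add: P_def)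
      then have "\<not> (\<exists>q\<in>N. \<forall>p\<in>P. sq_dist x q < sq_dist x p)"
        using nearest by (auto simp: N_def not_less intro!: bexI[of _ "step_point n i"])
      ultimately show ?thesis using fi True by simp
    next
      case False
      have "\<exists>q\<in>N. \<forall>p\<in>P. sq_dist x q < sq_dist x p"
        using False i less strict by (auto simp: P_def N_def intro!: bexI[of _ i])
      moreover have "step_point n i \<in> N" using False i(1) by (simp add: N_def)
      then have "\<not> (\<exists>p\<in>P. \<forall>q\<in>N. sq_dist x p < sq_dist x q)"
        using nearest by (auto simp: P_def not_less intro!: bexI[of _ "step_point n i"])
      ultimately show ?thesis using fi False by simp
    qed
  qed
  have sub: "P \<subseteq> cube n" "N \<subseteq> cube n"
    by (auto simp: P_def N_def cube_def step_point_def)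
  have "HNN_rep n walk_parity P N"
    unfolding HNN_rep_def by (intro main sub disj conjI ballI)
  moreover have "card (P \<union> N) = n + 1"
    using step_point_inj[of n] by (simp add: PN card_image)
  ultimately show ?thesis by blast
qed

lemma walk_replicate [simp]: "walk (replicate c x) = (if x then - int c else int c)"
  by (induction c) auto

lemma walk_min_replicate [simp]: "walk_min (replicate c x) = (if x then - int c else 0)"
  by (induction c) auto

subsection \<open>Embedding levels of gadgets into a walk\<close>

text \<open>The first run lifts the walk to \<open>c\<close>, so that two runs down are needed to become negative: after the
  runs for \<open>p\<close> and \<open>q\<close> the height is \<open>- c\<close> if both are true, and otherwise \<open>c\<close> or \<open>3c\<close>. Each bit depends
  on at most one of \<open>p\<close> and \<open>q\<close>.\<close>

definition block :: "nat \<Rightarrow> bool \<Rightarrow> bool \<Rightarrow> bool list" where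
  "block c p q = replicate c False @ replicate c p @ replicate c q @
     replicate c (\<not> p) @ replicate c (\<not> q) @ replicate c True"

lemma walk_block [simp]: "walk (block c p q) = 0"
  by (simp add: block_def)

lemma walk_min_block [simp]: "walk_min (block c p q) = (if p \<and> q then - int c else 0)"
  by (auto simp: block_def walk_min_append)

lemma length_block [simp]: "length (block c p q) = 6 * c"
  by (simp add: block_def)

text \<open>The first player owns \<open>fst z\<close>, the true bits of each row; the second owns
  \<open>snd z\<close>, the column selected in each row. Every block returns to height 0, so the
  minimum over the concatenation is a disjunction of the block tests.\<close>

definition level_word :: "nat \<Rightarrow> nat \<Rightarrow> nat \<Rightarrow> (nat \<Rightarrow> nat set) \<times> (nat \<Rightarrow> nat) \<Rightarrow> bool list" where
  "level_word m b c z = concat (map (\<lambda>(i, j). block c (j \<in> fst z i) (snd z i = j))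
     (List.product [0..<m] [0..<b]))"

text \<open>The levels are numbered from \<open>c + 1\<close>.\<close>

fun word :: "nat \<Rightarrow> nat \<Rightarrow> nat \<Rightarrow> ((nat \<Rightarrow> nat set) \<times> (nat \<Rightarrow> nat)) list \<Rightarrow> bool list" where
  "word m b c [] = []"
| "word m b c (z # zs) = level_word m b (Suc c) z @ word m b (Suc c) zs"

abbreviation rows :: "nat \<Rightarrow> nat \<Rightarrow> (nat \<Rightarrow> nat set) set" where
  "rows m b \<equiv> {..<m} \<rightarrow>\<^sub>E Pow {..<b}"

abbreviation selectors :: "nat \<Rightarrow> nat \<Rightarrow> (nat \<Rightarrow> nat) set" where
  "selectors m b \<equiv> {..<m} \<rightarrow>\<^sub>E {..<b}"

definition fired :: "nat \<Rightarrow> (nat \<Rightarrow> nat set) \<times> (nat \<Rightarrow> nat) \<Rightarrow> bool" where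
  "fired m z \<longleftrightarrow> (\<exists>i<m. snd z i \<in> fst z i)"

lemma walk_blocks: "walk (concat (map (\<lambda>(i, j). block c (p i j) (q i j)) ijs)) = 0"
  by (induction ijs) auto

lemma walk_min_blocks:
  "walk_min (concat (map (\<lambda>(i, j). block c (p i j) (q i j)) ijs))
   = (if \<exists>(i, j)\<in>set ijs. p i j \<and> q i j then - int c else 0)"
  by (induction ijs) (auto simp: walk_min_append split: if_splits)

lemma walk_level_word [simp]: "walk (level_word m b c z) = 0"
  by (simp add: level_word_def walk_blocks)

lemma walk_min_level_word:
  assumes "snd z \<in> selectors m b"
  shows "walk_min (level_word m b c z) = (if fired m z then - int c else 0)"
proof -
  have "(\<exists>(i, j)\<in>set (List.product [0..<m] [0..<b]). j \<in> fst z i \<and> snd z i = j) \<longleftrightarrow> fired m z"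
    using assms by (auto simp: fired_def PiE_iff)
  then show ?thesis unfolding level_word_def walk_min_blocks by simp
qed

lemma length_level_word: "length (level_word m b c z) = 6 * m * b * c"
proof -
  have "length (concat (map (\<lambda>(i, j). block c (j \<in> fst z i) (snd z i = j)) ijs)) = 6 * c * length ijs" for ijs
    by (induction ijs) auto
  then show ?thesis by (simp add: level_word_def)
qed

lemma length_word: "length (word m b c zs) = 6 * m * b * (\<Sum>i<length zs. Suc c + i)"
proof (induction zs arbitrary: c)
  case (Cons z zs)
  have "(\<Sum>i<Suc (length zs). Suc c + i) = Suc c + (\<Sum>i<length zs. Suc (Suc c) + i)"
    by (subst sum.lessThan_Suc_shift) simp
  then show ?case using Cons by (simp add: length_level_word algebra_simps)
qed simp

lemma walk_word [simp]: "walk (word m b c zs) = 0"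
  by (induction zs arbitrary: c) auto

lemma word_append: "word m b c (s @ t) = word m b c s @ word m b (c + length s) t"
  by (induction s arbitrary: c) auto

lemma walk_min_word_unfired:
  assumes "\<forall>z\<in>set t. snd z \<in> selectors m b \<and> \<not> fired m z"
  shows "walk_min (word m b c t) = 0"
  using assms by (induction t arbitrary: c) (auto simp: walk_min_append walk_min_level_word)

lemma walk_min_word_ge:
  assumes "\<forall>z\<in>set s. snd z \<in> selectors m b"
  shows "walk_min (word m b c s) \<ge> - int (c + length s)"
  using assms
proof (induction s arbitrary: c)
  case (Cons z s)
  have "walk_min (word m b (Suc c) s) \<ge> - int (Suc c + length s)"
    by (rule Cons.IH) (use Cons.prems in auto)
  then show ?case using Cons.prems by (auto simp: walk_min_append walk_min_level_word)
qed simp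

text \<open>When level \<open>l\<close> fires it reaches depth \<open>- l\<close>, so the last fired
  level determines the minimum whatever the earlier levels do. If none fires, the minimum is 0, in
  accordance with \<open>s = []\<close>.\<close>

lemma walk_parity_word:
  assumes s: "\<forall>z\<in>set s. snd z \<in> selectors m b" "s = [] \<or> fired m (last s)"
    and t: "\<forall>z\<in>set t. snd z \<in> selectors m b \<and> \<not> fired m z"
  shows "walk_parity (word m b 0 (s @ t)) \<longleftrightarrow> even (length s)"
proof -
  have "walk_min (word m b 0 s) = - int (length s)"
  proof (cases s rule: rev_cases)
    case (snoc s' z)
    then have "walk_min (word m b 0 s') \<ge> - int (length s')"
      using walk_min_word_ge[of s' m b 0] s by simp
    then show ?thesis using snoc s
      by (auto simp: word_append walk_min_append walk_min_level_word)
  qed simp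
  then have "walk_min (word m b 0 (s @ t)) = - int (length s)"
    using walk_min_word_unfired[OF t] by (simp add: word_append walk_min_append)
  then show ?thesis by (simp add: walk_parity_def)
qed

subsection \<open>Amplification along the levels\<close>

text \<open>The average of \<open>H\<close> over lists of \<open>j\<close> independent entries with distribution \<open>p\<close>.\<close>

primrec avg :: "'z set \<Rightarrow> ('z \<Rightarrow> real) \<Rightarrow> nat \<Rightarrow> ('z list \<Rightarrow> real) \<Rightarrow> real" where
  "avg Z p 0 H = H []"
| "avg Z p (Suc j) H = (\<Sum>z\<in>Z. p z * avg Z p j (\<lambda>t. H (z # t)))"

lemma avg_sum: "avg Z p j (\<lambda>t. \<Sum>x\<in>A. c x * H x t) = (\<Sum>x\<in>A. c x * avg Z p j (H x))"
proof (induction j arbitrary: H)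
  case (Suc j)
  have "avg Z p (Suc j) (\<lambda>t. \<Sum>x\<in>A. c x * H x t)
      = (\<Sum>z\<in>Z. \<Sum>x\<in>A. p z * (c x * avg Z p j (\<lambda>t. H x (z # t))))"
    by (simp add: Suc.IH sum_distrib_left)
  also have "\<dots> = (\<Sum>x\<in>A. \<Sum>z\<in>Z. p z * (c x * avg Z p j (\<lambda>t. H x (z # t))))"
    by (rule sum.swap)
  also have "\<dots> = (\<Sum>x\<in>A. c x * avg Z p (Suc j) (H x))"
    by (simp add: sum_distrib_left mult_ac)
  finally show ?case .
qed simp

lemma avg_scale: "avg Z p j (\<lambda>t. c * H t) = c * avg Z p j H"
  using avg_sum[of Z p j "\<lambda>_. c" "\<lambda>_. H" "{()}"] by simp

lemma avg_ge:
  assumes "\<And>z. z \<in> Z \<Longrightarrow> 0 \<le> p z" "sum p Z = 1"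
    and "\<And>t. length t = j \<Longrightarrow> set t \<subseteq> Z \<Longrightarrow> c \<le> H t"
  shows "c \<le> avg Z p j H"
  using assms(3)
proof (induction j arbitrary: H)
  case (Suc j)
  have "c \<le> avg Z p j (\<lambda>t. H (z # t))" if "z \<in> Z" for z
    by (rule Suc.IH) (use Suc.prems that in auto)
  then have "(\<Sum>z\<in>Z. p z * c) \<le> avg Z p (Suc j) H"
    using assms(1) by (auto intro!: sum_mono mult_left_mono)
  then show ?case using assms(2) by (simp flip: sum_distrib_right)
qed simp

text \<open>\<open>Z0\<close> consists of the inputs that do not fire. The higher levels of a prefix \<open>s\<close> are averaged over \<open>Z0\<close>,
  and \<open>s\<close> is extended by an entry outside \<open>Z0\<close> at which this average at least doubles.\<close>

lemma sign_amplification: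
  fixes \<psi> :: "'z \<Rightarrow> real" and H :: "'z list \<Rightarrow> real"
  assumes Z: "finite Z" "Z0 \<subseteq> Z"
    and nonneg: "\<And>z. z \<in> Z0 \<Longrightarrow> 0 \<le> \<psi> z" and one: "sum \<psi> Z0 = 1"
    and pos: "(\<Sum>z\<in>Z - Z0. max (\<psi> z) 0) \<le> 1/4"
    and sign: "\<And>s t. length s + length t = k \<Longrightarrow> set s \<subseteq> Z \<Longrightarrow> set t \<subseteq> Z0 \<Longrightarrow>
      s = [] \<or> last s \<in> Z - Z0 \<Longrightarrow> 1 \<le> (-1) ^ length s * H (s @ t)"
    and disc: "\<And>s t. length s + length t + 1 = k \<Longrightarrow> set s \<subseteq> Z \<Longrightarrow> set t \<subseteq> Z \<Longrightarrow>
      \<bar>\<Sum>z\<in>Z. \<psi> z * H (s @ z # t)\<bar> \<le> \<eta>"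
    and \<eta>: "\<eta> < 1/2"
  shows "\<exists>s. length s = k \<and> set s \<subseteq> Z \<and> 2 ^ k \<le> \<bar>H s\<bar>"
proof -
  note ge = avg_ge[of Z0 \<psi>, OF nonneg one]
  \<comment> \<open>Keeping the last entry of the prefix outside \<open>Z0\<close> makes
    \<open>sign\<close> applicable to every completion by entries of \<open>Z0\<close>.\<close>
  have "\<exists>s. length s = l \<and> set s \<subseteq> Z \<and> (s = [] \<or> last s \<in> Z - Z0) \<and>
      2 ^ l \<le> (-1) ^ l * avg Z0 \<psi> (k - l) (\<lambda>t. H (s @ t))" if "l \<le> k" for l
    using that
  proof (induction l)
    case 0
    have "1 \<le> avg Z0 \<psi> k H"
      by (rule ge) (use sign[of "[]"] in auto)
    then show ?case by simp
  next
    case (Suc l)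
    then obtain s where s: "length s = l" "set s \<subseteq> Z" "s = [] \<or> last s \<in> Z - Z0"
      and big: "2 ^ l \<le> (-1) ^ l * avg Z0 \<psi> (k - l) (\<lambda>t. H (s @ t))"
      using Suc.IH Suc_leD[OF Suc.prems] by blast
    define j where "j = k - Suc l"
    have j: "k - l = Suc j" "k - Suc l = j" "l + j + 1 = k"
      using Suc.prems by (simp_all add: j_def)
    define e :: real where "e = (-1) ^ l"
    define A where "A z = e * avg Z0 \<psi> j (\<lambda>t. H (s @ z # t))" for z
    have A: "A z = avg Z0 \<psi> j (\<lambda>t. e * H (s @ z # t))" for z
      by (simp add: A_def avg_scale)
    have "(\<Sum>z\<in>Z. \<psi> z * A z) = avg Z0 \<psi> j (\<lambda>t. \<Sum>z\<in>Z. \<psi> z * (e * H (s @ z # t)))"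
      by (simp add: A avg_sum)
    \<comment> \<open>\<open>avg_ge\<close> yields lower bounds only, so the upper bound on this
      average is obtained by negating twice.\<close>
    then have "(\<Sum>z\<in>Z. \<psi> z * A z) = - avg Z0 \<psi> j (\<lambda>t. - 1 * (\<Sum>z\<in>Z. \<psi> z * (e * H (s @ z # t))))"
      by (subst avg_scale) simp
    moreover have "- \<eta> \<le> avg Z0 \<psi> j (\<lambda>t. - 1 * (\<Sum>z\<in>Z. \<psi> z * (e * H (s @ z # t))))"
    proof (rule ge)
      fix t assume t: "length t = j" "set t \<subseteq> Z0"
      have "(\<Sum>z\<in>Z. \<psi> z * (e * H (s @ z # t))) = e * (\<Sum>z\<in>Z. \<psi> z * H (s @ z # t))"
        by (simp add: sum_distrib_left mult_ac)
      also have "\<dots> \<le> \<bar>\<Sum>z\<in>Z. \<psi> z * H (s @ z # t)\<bar>"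
        by (cases "even l") (auto simp: e_def)
      also have "\<dots> \<le> \<eta>" using disc[of s t] s t Z j by auto
      finally show "- \<eta> \<le> - 1 * (\<Sum>z\<in>Z. \<psi> z * (e * H (s @ z # t)))" by simp
    qed
    ultimately have total: "(\<Sum>z\<in>Z. \<psi> z * A z) \<le> \<eta>" by linarith
    \<comment> \<open>Unfolding the first averaged level turns the invariant into the part of the
      sum over \<open>Z0\<close>.\<close>
    have low: "2 ^ l \<le> (\<Sum>z\<in>Z0. \<psi> z * A z)"
      using big by (simp add: j A_def e_def sum_distrib_left mult_ac)
    \<comment> \<open>Appending an entry outside \<open>Z0\<close> lengthens the prefix by one,
      which flips the sign of \<open>H\<close>.\<close>
    have neg: "1 \<le> - A z" if "z \<in> Z - Z0" for z
    proof -
      have "1 \<le> avg Z0 \<psi> j (\<lambda>t. - e * H (s @ z # t))"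
      proof (rule ge)
        fix t assume t: "length t = j" "set t \<subseteq> Z0"
        show "1 \<le> - e * H (s @ z # t)"
          using sign[of "s @ [z]" t] s t that j by (simp add: e_def)
      qed
      then show ?thesis by (subst (asm) avg_scale) (simp add: A_def)
    qed
    \<comment> \<open>Otherwise the entries outside \<open>Z0\<close> cancel at most
      \<open>1/4 * 2 ^ Suc l = 2 ^ l / 2\<close> of the contribution of \<open>Z0\<close>, which is
      at least \<open>2 ^ l\<close>; the remainder of at least 1/2 exceeds \<eta>.\<close>
    have "\<exists>z\<in>Z - Z0. 2 ^ Suc l \<le> - A z"
    proof (rule ccontr)
      assume "\<not> ?thesis"
      then have lt: "- A z < 2 ^ Suc l" if "z \<in> Z - Z0" for z using that by force
      have "(\<Sum>z\<in>Z - Z0. \<psi> z * - A z) \<le> (\<Sum>z\<in>Z - Z0. max (\<psi> z) 0 * 2 ^ Suc l)"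
      proof (rule sum_mono)
        fix z assume z: "z \<in> Z - Z0"
        have "\<psi> z * - A z \<le> max (\<psi> z) 0 * - A z"
          using neg[OF z] by (intro mult_right_mono) auto
        also have "\<dots> \<le> max (\<psi> z) 0 * 2 ^ Suc l"
          using lt[OF z] by (intro mult_left_mono) auto
        finally show "\<psi> z * - A z \<le> max (\<psi> z) 0 * 2 ^ Suc l" .
      qed
      also have "\<dots> \<le> 1/4 * 2 ^ Suc l"
        unfolding sum_distrib_right[symmetric] by (rule mult_right_mono[OF pos]) simp
      finally have "(\<Sum>z\<in>Z - Z0. \<psi> z * - A z) \<le> 2 ^ l / 2" by simp
      moreover have "(\<Sum>z\<in>Z. \<psi> z * A z) = (\<Sum>z\<in>Z0. \<psi> z * A z) - (\<Sum>z\<in>Z - Z0. \<psi> z * - A z)"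
        using Z by (simp add: sum.subset_diff[of Z0 Z] sum_negf)
      ultimately have "2 ^ l / 2 \<le> \<eta>" using low total by linarith
      moreover have "(1::real) \<le> 2 ^ l" by simp
      ultimately show False using \<eta> by linarith
    qed
    then obtain z where z: "z \<in> Z - Z0" "2 ^ Suc l \<le> - A z" by blast
    then show ?case using s j
      by (intro exI[of _ "s @ [z]"]) (auto simp: A_def e_def)
  qed
  from this[of k] obtain s where s: "length s = k" "set s \<subseteq> Z" "2 ^ k \<le> (-1) ^ k * H s"
    by auto
  have "(-1) ^ k * H s \<le> \<bar>H s\<bar>" by (cases "even k") auto
  then show ?thesis using s by (intro exI[of _ s]) auto
qed

subsection \<open>Rectangle weight of depth-two majority circuits\<close>

text \<open>By duality this says that \<open>F\<close> is essentially a combination of indicators of combinatorial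
  rectangles with coefficients of total absolute value at most \<open>W\<close>.\<close>

definition rect_bound :: "real \<Rightarrow> ('a \<Rightarrow> 'b \<Rightarrow> real) \<Rightarrow> bool" where
  "rect_bound W F \<longleftrightarrow> (\<forall>X Y \<psi> \<delta>. finite X \<longrightarrow> finite Y \<longrightarrow>
     (\<forall>A\<subseteq>X. \<forall>B\<subseteq>Y. \<bar>\<Sum>x\<in>A. \<Sum>y\<in>B. \<psi> x y\<bar> \<le> \<delta>) \<longrightarrow>
     \<bar>\<Sum>x\<in>X. \<Sum>y\<in>Y. \<psi> x y * F x y\<bar> \<le> W * \<delta>)"

lemma rect_boundD:
  assumes "rect_bound W F" "finite X" "finite Y"
    and "\<And>A B. A \<subseteq> X \<Longrightarrow> B \<subseteq> Y \<Longrightarrow> \<bar>\<Sum>x\<in>A. \<Sum>y\<in>B. \<psi> x y\<bar> \<le> \<delta>"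
  shows "\<bar>\<Sum>x\<in>X. \<Sum>y\<in>Y. \<psi> x y * F x y\<bar> \<le> W * \<delta>"
  using assms unfolding rect_bound_def by blast

text \<open>Test against the unit mass at a single point.\<close>

lemma rect_bound_value:
  assumes "rect_bound W F"
  shows "\<bar>F x y\<bar> \<le> W"
proof -
  have "\<bar>\<Sum>x\<in>A. \<Sum>y\<in>B. 1\<bar> \<le> (1::real)" if "A \<subseteq> {x}" "B \<subseteq> {y}" for A B
    using that by (auto simp: subset_singleton_iff)
  with rect_boundD[OF assms, of "{x}" "{y}" "\<lambda>_ _. 1" 1] show ?thesis by simp
qed

lemma rect_bound_mono:
  fixes F :: "'a \<Rightarrow> 'b \<Rightarrow> real"
  assumes "rect_bound W F" "W \<le> W'"
  shows "rect_bound W' F"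
  unfolding rect_bound_def
proof (intro allI impI)
  fix X :: "'a set" and Y :: "'b set" and \<psi> :: "'a \<Rightarrow> 'b \<Rightarrow> real" and \<delta> :: real
  assume a: "finite X" "finite Y" "\<forall>A\<subseteq>X. \<forall>B\<subseteq>Y. \<bar>\<Sum>x\<in>A. \<Sum>y\<in>B. \<psi> x y\<bar> \<le> \<delta>"
  \<comment> \<open>The empty rectangle forces the sign of \<delta>.\<close>
  have "0 \<le> \<delta>" using a(3)[rule_format, of "{}" "{}"] by simp
  then have "W * \<delta> \<le> W' * \<delta>" using assms(2) by (rule mult_right_mono[rotated])
  moreover have "\<bar>\<Sum>x\<in>X. \<Sum>y\<in>Y. \<psi> x y * F x y\<bar> \<le> W * \<delta>"
    by (rule rect_boundD[OF assms(1) a(1,2)]) (use a(3) in blast)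
  ultimately show "\<bar>\<Sum>x\<in>X. \<Sum>y\<in>Y. \<psi> x y * F x y\<bar> \<le> W' * \<delta>" by linarith
qed

text \<open>Multiplying by the indicator restricts the double sum to a rectangle inside
  \<open>X\<close> and \<open>Y\<close>, where the assumption on \<psi> applies directly.\<close>

lemma rect_bound_rectangle:
  fixes P :: "'a \<Rightarrow> bool" and Q :: "'b \<Rightarrow> bool"
  shows "rect_bound 1 (\<lambda>x y. of_bool (P x \<and> Q y))"
  unfolding rect_bound_def
proof (intro allI impI)
  fix X :: "'a set" and Y :: "'b set" and \<psi> :: "'a \<Rightarrow> 'b \<Rightarrow> real" and \<delta> :: real
  assume a: "finite X" "finite Y" "\<forall>A\<subseteq>X. \<forall>B\<subseteq>Y. \<bar>\<Sum>x\<in>A. \<Sum>y\<in>B. \<psi> x y\<bar> \<le> \<delta>"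
  have "(\<Sum>x\<in>X. \<Sum>y\<in>Y. \<psi> x y * of_bool (P x \<and> Q y))
      = (\<Sum>x\<in>X. if P x then \<Sum>y\<in>Y. if Q y then \<psi> x y else 0 else 0)"
    by (intro sum.cong refl) (auto intro!: sum.cong)
  also have "\<dots> = (\<Sum>x\<in>X \<inter> Collect P. \<Sum>y\<in>Y \<inter> Collect Q. \<psi> x y)"
    using a by (simp add: sum.If_cases)
  finally show "\<bar>\<Sum>x\<in>X. \<Sum>y\<in>Y. \<psi> x y * of_bool (P x \<and> Q y)\<bar> \<le> 1 * \<delta>"
    using a by simp
qed

lemma rect_bound_sum:
  fixes F :: "'i \<Rightarrow> 'a \<Rightarrow> 'b \<Rightarrow> real"
  assumes "\<And>i. i \<in> I \<Longrightarrow> rect_bound (W i) (F i)"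
  shows "rect_bound (\<Sum>i\<in>I. \<bar>c i\<bar> * W i) (\<lambda>x y. \<Sum>i\<in>I. c i * F i x y)"
  unfolding rect_bound_def
proof (intro allI impI)
  fix X :: "'a set" and Y :: "'b set" and \<psi> :: "'a \<Rightarrow> 'b \<Rightarrow> real" and \<delta> :: real
  assume a: "finite X" "finite Y" "\<forall>A\<subseteq>X. \<forall>B\<subseteq>Y. \<bar>\<Sum>x\<in>A. \<Sum>y\<in>B. \<psi> x y\<bar> \<le> \<delta>"
  have "(\<Sum>x\<in>X. \<Sum>y\<in>Y. \<psi> x y * (\<Sum>i\<in>I. c i * F i x y))
      = (\<Sum>x\<in>X. \<Sum>i\<in>I. \<Sum>y\<in>Y. \<psi> x y * (c i * F i x y))"
    by (intro sum.cong refl) (simp add: sum_distrib_left sum.swap[of _ I])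
  also have "\<dots> = (\<Sum>i\<in>I. c i * (\<Sum>x\<in>X. \<Sum>y\<in>Y. \<psi> x y * F i x y))"
    by (subst sum.swap) (simp add: sum_distrib_left mult_ac)
  also have "\<bar>\<dots>\<bar> \<le> (\<Sum>i\<in>I. \<bar>c i\<bar> * \<bar>\<Sum>x\<in>X. \<Sum>y\<in>Y. \<psi> x y * F i x y\<bar>)"
    by (rule order_trans[OF sum_abs]) (simp add: abs_mult)
  also have "\<dots> \<le> (\<Sum>i\<in>I. \<bar>c i\<bar> * (W i * \<delta>))"
    by (intro sum_mono mult_left_mono rect_boundD[OF assms]) (use a in auto)
  finally show "\<bar>\<Sum>x\<in>X. \<Sum>y\<in>Y. \<psi> x y * (\<Sum>i\<in>I. c i * F i x y)\<bar> \<le> (\<Sum>i\<in>I. \<bar>c i\<bar> * W i) * \<delta>"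
    by (simp add: sum_distrib_left sum_distrib_right mult_ac)
qed

lemma rect_bound_affine:
  assumes "rect_bound W F"
  shows "rect_bound (\<bar>c\<bar> * W + \<bar>d\<bar>) (\<lambda>x y. c * F x y + d)"
proof -
  \<comment> \<open>The constant 1 enters as the indicator of the full rectangle.\<close>
  define G where "G i = (if i then F else (\<lambda>x y. of_bool (True \<and> True)))" for i
  have "rect_bound (\<Sum>i\<in>UNIV. \<bar>if i then c else d\<bar> * (if i then W else 1))
      (\<lambda>x y. \<Sum>i\<in>UNIV. (if i then c else d) * G i x y)"
    using assms rect_bound_rectangle[of "\<lambda>_. True" "\<lambda>_. True"]
    by (intro rect_bound_sum) (auto simp: G_def)
  then show ?thesis by (simp add: UNIV_bool G_def add.commute)
qed

text \<open>Split by the value \<open>c\<close> of \<open>\<alpha> x\<close>. Each of the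
  \<open>2R + 1\<close> possible values gives one rectangle, since the condition left on
  \<open>y\<close> involves only \<open>c\<close>.\<close>

lemma rect_bound_threshold:
  fixes \<alpha> :: "'a \<Rightarrow> int" and \<beta> :: "'b \<Rightarrow> int"
  assumes "\<And>x. \<bar>\<alpha> x\<bar> \<le> int R"
  shows "rect_bound (2 * real R + 1) (\<lambda>x y. of_bool (\<alpha> x + \<beta> y \<ge> \<theta>))"
proof -
  have "of_bool (\<alpha> x + \<beta> y \<ge> \<theta>)
      = (\<Sum>c\<in>{- int R..int R}. 1 * (of_bool (\<alpha> x = c \<and> \<beta> y \<ge> \<theta> - c) :: real))" for x y
  proof -
    have "(\<Sum>c\<in>{- int R..int R}. 1 * (of_bool (\<alpha> x = c \<and> \<beta> y \<ge> \<theta> - c) :: real))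
        = (\<Sum>c\<in>{- int R..int R}. if c = \<alpha> x then of_bool (\<beta> y \<ge> \<theta> - \<alpha> x) else 0)"
      by (intro sum.cong) auto
    also have "\<dots> = of_bool (\<beta> y \<ge> \<theta> - \<alpha> x)"
      using assms[of x] by (subst sum.delta) auto
    also have "\<dots> = of_bool (\<alpha> x + \<beta> y \<ge> \<theta>)" by (simp add: algebra_simps)
    finally show ?thesis ..
  qed
  moreover have "rect_bound (\<Sum>c\<in>{- int R..int R}. \<bar>1\<bar> * 1)
      (\<lambda>x y. \<Sum>c\<in>{- int R..int R}. 1 * (of_bool (\<alpha> x = c \<and> \<beta> y \<ge> \<theta> - c) :: real))"
    by (intro rect_bound_sum rect_bound_rectangle)
  ultimately show ?thesis by (simp add: add.commute)
qed

section \<open>Words whose bits are divided between two players\<close>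

definition separated :: "('a \<Rightarrow> 'b \<Rightarrow> bool list) \<Rightarrow> bool" where
  "separated w \<longleftrightarrow> (\<exists>hs. (\<forall>h\<in>set hs. (\<exists>p. h = (\<lambda>x y. p x)) \<or> (\<exists>q. h = (\<lambda>x y. q y))) \<and>
     w = (\<lambda>x y. map (\<lambda>h. h x y) hs))"

lemma separated_const: "separated (\<lambda>x y. v)"
  unfolding separated_def by (rule exI[of _ "map (\<lambda>b x y. b) v"]) (auto simp: comp_def)

lemma separated_replicate_left: "separated (\<lambda>x y. replicate c (p x))"
  unfolding separated_def by (rule exI[of _ "replicate c (\<lambda>x y. p x)"]) auto

lemma separated_replicate_right: "separated (\<lambda>x y. replicate c (q y))"
  unfolding separated_def by (rule exI[of _ "replicate c (\<lambda>x y. q y)"]) auto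

lemma separated_append:
  assumes "separated v" "separated w"
  shows "separated (\<lambda>x y. v x y @ w x y)"
proof -
  from assms obtain hs hs' where
    "\<forall>h\<in>set hs. (\<exists>p. h = (\<lambda>x y. p x)) \<or> (\<exists>q. h = (\<lambda>x y. q y))" "v = (\<lambda>x y. map (\<lambda>h. h x y) hs)"
    "\<forall>h\<in>set hs'. (\<exists>p. h = (\<lambda>x y. p x)) \<or> (\<exists>q. h = (\<lambda>x y. q y))" "w = (\<lambda>x y. map (\<lambda>h. h x y) hs')"
    unfolding separated_def by blast
  then show ?thesis unfolding separated_def by (intro exI[of _ "hs @ hs'"]) auto
qed

lemma separated_Not:
  assumes "separated w"
  shows "separated (\<lambda>x y. map Not (w x y))"
proof -
  from assms obtain hs where
    hs: "\<forall>h\<in>set hs. (\<exists>p. h = (\<lambda>x y. p x)) \<or> (\<exists>q. h = (\<lambda>x y. q y))" "w = (\<lambda>x y. map (\<lambda>h. h x y) hs)"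
    unfolding separated_def by blast
  show ?thesis unfolding separated_def
  proof (intro exI[of _ "map (\<lambda>h x y. \<not> h x y) hs"] conjI ballI)
    fix h assume "h \<in> set (map (\<lambda>h x y. \<not> h x y) hs)"
    then obtain g where "g \<in> set hs" "h = (\<lambda>x y. \<not> g x y)" by auto
    with hs show "(\<exists>p. h = (\<lambda>x y. p x)) \<or> (\<exists>q. h = (\<lambda>x y. q y))" by auto
  qed (simp add: hs comp_def)
qed

lemma separated_concat:
  assumes "\<And>i. separated (w i)"
  shows "separated (\<lambda>x y. concat (map (\<lambda>i. w i x y) is))"
  by (induction "is") (auto intro: separated_const separated_append assms)

lemma separated_bottom_inputs: "separated w \<Longrightarrow> separated (\<lambda>x y. bottom_inputs (w x y))"
  unfolding bottom_inputs_def by (intro separated_append separated_Not separated_const)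

text \<open>The weighted sum splits into a part for each player, which reduces the gate to
  \<open>rect_bound_threshold\<close>. The first part is bounded by the number of inputs times the
  largest weight.\<close>

lemma rect_bound_gate:
  assumes w: "separated w" and g: "bounded_gate N B g" and len: "\<And>x y. length (w x y) = N"
  shows "rect_bound (2 * real (N * B) + 1) (\<lambda>x y. of_bool (gate_output g (w x y)))"
proof -
  from w obtain hs where
    hs: "\<forall>h\<in>set hs. (\<exists>p. h = (\<lambda>x y. p x)) \<or> (\<exists>q. h = (\<lambda>x y. q y))" "w = (\<lambda>x y. map (\<lambda>h. h x y) hs)"
    unfolding separated_def by blast
  have N: "length hs = N" using len hs(2) by simp
  define I where "I = {i\<in>{..<N}. \<exists>p. hs ! i = (\<lambda>x y. p x)}"
  have I: "I \<subseteq> {..<N}" by (auto simp: I_def)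
  \<comment> \<open>\<open>undefined\<close> fills the argument on which the bit does not
    depend.\<close>
  define \<alpha> where "\<alpha> x = (\<Sum>i\<in>I. weights g ! i * of_bool ((hs ! i) x undefined))" for x
  define \<beta> where "\<beta> y = (\<Sum>i\<in>{..<N} - I. weights g ! i * of_bool ((hs ! i) undefined y))" for y
  have left: "(hs ! i) x y = (hs ! i) x undefined" if "i \<in> I" for i x y
    using that by (auto simp: I_def)
  have right: "(hs ! i) x y = (hs ! i) undefined y" if "i \<in> {..<N} - I" for i x y
  proof -
    have "hs ! i \<in> set hs" using that N by auto
    then have "\<exists>q. hs ! i = (\<lambda>x y. q y)" using hs(1) that by (auto simp: I_def)
    then show ?thesis by auto
  qed
  have "(\<Sum>i<N. weights g ! i * of_bool ((hs ! i) x y)) = \<alpha> x + \<beta> y" for x y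
  proof -
    have "(\<Sum>i<N. weights g ! i * of_bool ((hs ! i) x y))
        = (\<Sum>i\<in>{..<N} - I. weights g ! i * of_bool ((hs ! i) x y)) + (\<Sum>i\<in>I. weights g ! i * of_bool ((hs ! i) x y))"
      by (rule sum.subset_diff) (use I in auto)
    also have "(\<Sum>i\<in>I. weights g ! i * of_bool ((hs ! i) x y)) = \<alpha> x"
      unfolding \<alpha>_def by (intro sum.cong refl) (simp add: left[of _ x y])
    also have "(\<Sum>i\<in>{..<N} - I. weights g ! i * of_bool ((hs ! i) x y)) = \<beta> y"
      unfolding \<beta>_def by (intro sum.cong refl) (simp add: right[of _ x y])
    finally show ?thesis by simp
  qed
  then have out: "gate_output g (w x y) \<longleftrightarrow> \<alpha> x + \<beta> y \<ge> threshold g" for x y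
    by (simp add: gate_output_def hs(2) N)
  have "\<bar>\<alpha> x\<bar> \<le> int (N * B)" for x
  proof -
    have "\<bar>\<alpha> x\<bar> \<le> (\<Sum>i\<in>I. \<bar>weights g ! i * of_bool ((hs ! i) x undefined)\<bar>)"
      unfolding \<alpha>_def by (rule sum_abs)
    also have "\<dots> \<le> (\<Sum>i\<in>I. int B)"
    proof (rule sum_mono)
      fix i assume "i \<in> I"
      then have "weights g ! i \<in> set (weights g)" using g I by (auto simp: bounded_gate_def)
      then show "\<bar>weights g ! i * of_bool ((hs ! i) x undefined)\<bar> \<le> int B"
        using g by (auto simp: bounded_gate_def)
    qed
    also have "\<dots> \<le> int (N * B)"
      using card_mono[OF _ I] by (simp add: mult_right_mono flip: of_nat_mult)
    finally show ?thesis .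
  qed
  then show ?thesis unfolding out by (rule rect_bound_threshold)
qed

text \<open>Doubling the linear form of the top gate and moving its threshold by one half gives an
  odd integer, so its sign is the output and its absolute value is at least 1.\<close>

definition depth2_value :: "threshold_gate \<Rightarrow> threshold_gate list \<Rightarrow> bool list \<Rightarrow> real" where
  "depth2_value t gs v = 2 * (\<Sum>i<length gs. real_of_int (weights t ! i) *
     of_bool (gate_output (gs ! i) (bottom_inputs v))) + (1 - 2 * real_of_int (threshold t))"

lemma depth2_value_sign:
  "if depth2_output t gs v then 1 \<le> depth2_value t gs v else depth2_value t gs v \<le> - 1"
proof -
  define S where "S = (\<Sum>i<length gs. weights t ! i * of_bool (gate_output (gs ! i) (bottom_inputs v)))"
  have "depth2_value t gs v = 2 * real_of_int S + (1 - 2 * real_of_int (threshold t))"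
    by (simp add: depth2_value_def S_def)
  moreover have "depth2_output t gs v \<longleftrightarrow> S \<ge> threshold t"
    by (simp add: depth2_output_def gate_output_def S_def)
  ultimately show ?thesis by auto
qed

lemma rect_bound_depth2:
  assumes w: "separated w" and len: "\<And>x y. length (w x y) = n"
    and t: "bounded_gate (length gs) B t" and gs: "\<forall>g\<in>set gs. bounded_gate (2 * n + 2) B g"
  defines "W \<equiv> 2 * (real (length gs) * (real B * (2 * real ((2 * n + 2) * B) + 1))) + (2 * real B + 1)"
  shows "rect_bound W (\<lambda>x y. depth2_value t gs (w x y))"
proof -
  let ?R = "2 * real ((2 * n + 2) * B) + 1"
  define out where "out i x y = (of_bool (gate_output (gs ! i) (bottom_inputs (w x y))) :: real)" for i x y
  define G where "G x y = (\<Sum>i<length gs. real_of_int (weights t ! i) * out i x y)" for x y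
  have "rect_bound ?R (out i)" if "i < length gs" for i
    unfolding out_def
    by (rule rect_bound_gate[OF separated_bottom_inputs[OF w]])
      (use that gs len in \<open>auto simp: bottom_inputs_def\<close>)
  then have "rect_bound (\<Sum>i<length gs. \<bar>real_of_int (weights t ! i)\<bar> * ?R) G"
    unfolding G_def by (intro rect_bound_sum) auto
  moreover have "(\<Sum>i<length gs. \<bar>real_of_int (weights t ! i)\<bar> * ?R) \<le> (\<Sum>i<length gs. real B * ?R)"
  proof (intro sum_mono mult_right_mono)
    fix i assume "i \<in> {..<length gs}"
    then have "\<bar>weights t ! i\<bar> \<le> int B" using t by (auto simp: bounded_gate_def)
    then show "\<bar>real_of_int (weights t ! i)\<bar> \<le> real B"
      by (metis of_int_abs of_int_le_iff of_int_of_nat_eq)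
  qed simp
  ultimately have "rect_bound (real (length gs) * (real B * ?R)) G"
    by (elim rect_bound_mono) simp
  then have "rect_bound (\<bar>2\<bar> * (real (length gs) * (real B * ?R)) + \<bar>1 - 2 * real_of_int (threshold t)\<bar>)
      (\<lambda>x y. depth2_value t gs (w x y))"
    unfolding depth2_value_def out_def[symmetric] G_def[symmetric] by (rule rect_bound_affine)
  moreover have "\<bar>threshold t\<bar> \<le> int B" using t by (simp add: bounded_gate_def)
  then have "\<bar>1 - 2 * real_of_int (threshold t)\<bar> \<le> 2 * real B + 1" by linarith
  ultimately show ?thesis
    unfolding W_def by (elim rect_bound_mono) simp
qed

subsection \<open>A gadget measure of small discrepancy\<close>

text \<open>A unit mass at 0 is cancelled on low degrees by nodes on one side, almost entirely with
  negative weights; adding each new node far beyond the old ones keeps the positive part small. The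
  bound 1/8 leaves room for a later factor 2.\<close>

lemma annihilating_measure_at_0:
  "\<exists>T w. finite T \<and> (\<forall>u\<in>T. (0::real) < u) \<and>
     (\<forall>q. degree q \<le> d \<longrightarrow> poly q 0 + (\<Sum>u\<in>T. w u * poly q u) = 0) \<and>
     (\<Sum>u\<in>T. max (w u) 0) < (1/8 :: real)"
proof (induction d)
  case 0
  show ?case
    by (intro exI[of _ "{1}"] exI[of _ "\<lambda>_. - 1"]) (auto elim!: degree_eq_zeroE)
next
  case (Suc d)
  then obtain T w where T: "finite T" "\<forall>u\<in>T. (0::real) < u"
    and w: "\<forall>q. degree q \<le> d \<longrightarrow> poly q 0 + (\<Sum>u\<in>T. w u * poly q u) = 0"
    and pos: "(\<Sum>u\<in>T. max (w u) 0) < (1/8 :: real)" by (elim exE conjE)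
  \<comment> \<open>A further node \<open>M\<close> raises the degree by one and multiplies the weight at \<open>u\<close> by \<open>M / (M - u)\<close>.
    For \<open>M\<close> tending to infinity the old weights are unchanged and the weight at \<open>M\<close> vanishes.\<close>
  define v where "v M u = w u * (M / (M - u))" for M u
  \<comment> \<open>This weight of the new node makes the functional vanish on constants.\<close>
  define r where "r M = - (1 + (\<Sum>u\<in>T. v M u))" for M
  have one: "1 + (\<Sum>u\<in>T. w u) = 0" using w[rule_format, of 1] by simp
  have v: "((\<lambda>M. v M u) \<longlongrightarrow> w u) at_top" for u
    unfolding v_def by real_asymp
  have "((\<lambda>M. (\<Sum>u\<in>T. max (v M u) 0) + max (r M) 0) \<longlongrightarrow>
      (\<Sum>u\<in>T. max (w u) 0) + max (- (1 + (\<Sum>u\<in>T. w u))) 0) at_top"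
    unfolding r_def by (intro tendsto_intros v)
  then have "eventually (\<lambda>M. (\<Sum>u\<in>T. max (v M u) 0) + max (r M) 0 < 1/8) at_top"
    by (rule order_tendstoD) (use pos one in simp)
  moreover have "eventually (\<lambda>M. \<forall>u\<in>T. u < M) at_top"
    using T(1) by (simp add: eventually_ball_finite_distrib eventually_gt_at_top)
  ultimately have "eventually (\<lambda>M. (\<Sum>u\<in>T. max (v M u) 0) + max (r M) 0 < 1/8 \<and> (\<forall>u\<in>T. u < M) \<and> 0 < M) at_top"
    using eventually_gt_at_top[of 0] by eventually_elim auto
  then obtain M where M: "(\<Sum>u\<in>T. max (v M u) 0) + max (r M) 0 < 1/8" "\<forall>u\<in>T. u < M" "0 < M"
    using eventually_happens'[OF trivial_limit_at_top_linorder] by blast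
  then have MT: "M \<notin> T" by auto
  define w' where "w' = (v M)(M := r M)"
  have sum_w': "(\<Sum>u\<in>insert M T. f (w' u) u) = f (r M) M + (\<Sum>u\<in>T. f (v M u) u)" for f :: "real \<Rightarrow> real \<Rightarrow> real"
  proof -
    have "(\<Sum>u\<in>T. f (w' u) u) = (\<Sum>u\<in>T. f (v M u) u)"
      using MT by (intro sum.cong) (auto simp: w'_def)
    then show ?thesis using T MT by (simp add: w'_def)
  qed
  have "poly q 0 + (\<Sum>u\<in>insert M T. w' u * poly q u) = 0" if "degree q \<le> Suc d" for q
  proof -
    \<comment> \<open>Dividing by \<open>X - M\<close> lowers the degree. The factor
      \<open>u - M\<close> cancels the denominator of \<open>v M u\<close>, which leaves the old
      functional applied to \<open>q'\<close>.\<close>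
    define q' where "q' = synthetic_div q M"
    have "poly q u = poly ([:- M, 1:] * q' + [:poly q M:]) u" for u
      unfolding q'_def synthetic_div_correct' ..
    then have q: "poly q u = poly q M + (u - M) * poly q' u" for u
      by (simp add: algebra_simps)
    have "v M u * poly q u = v M u * poly q M - M * (w u * poly q' u)" if "u \<in> T" for u
      using M(2) that by (subst q) (auto simp: v_def field_simps)
    then have "(\<Sum>u\<in>T. v M u * poly q u) = (\<Sum>u\<in>T. v M u) * poly q M - M * (\<Sum>u\<in>T. w u * poly q' u)"
      by (simp add: sum_subtractf sum_distrib_left sum_distrib_right)
    moreover have deg: "degree q' \<le> d" using that by (simp add: q'_def degree_synthetic_div)
    moreover have "M * (\<Sum>u\<in>T. w u * poly q' u) = - (M * poly q' 0)"
      using w[rule_format, OF deg] by (simp add: eq_neg_iff_add_eq_0 add.commute flip: distrib_left)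
    moreover have "r M * poly q M = - poly q M - (\<Sum>u\<in>T. v M u) * poly q M"
      by (simp add: r_def algebra_simps)
    ultimately show ?thesis
      using q[of 0] sum_w'[of "\<lambda>a u. a * poly q u"] by simp
  qed
  moreover have "(\<Sum>u\<in>insert M T. max (w' u) 0) < 1/8"
    using sum_w'[of "\<lambda>a u. max a 0"] M(1) by simp
  ultimately show ?case using T M(3)
    by (intro exI[of _ "insert M T"] exI[of _ w']) auto
qed

text \<open>The affine map sending \<open>u\<close> to \<open>1 - u / M\<close> takes 0 to 1 and the
  nodes into \<open>[0,1)\<close>, and substituting it preserves the degree bound.\<close>

lemma annihilating_measure_at_1:
  "\<exists>T w. finite T \<and> T \<subseteq> {0..<1::real} \<and>
     (\<forall>q. degree q \<le> d \<longrightarrow> poly q 1 + (\<Sum>\<theta>\<in>T. w \<theta> * poly q \<theta>) = 0) \<and>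
     (\<Sum>\<theta>\<in>T. max (w \<theta>) 0) < (1/8 :: real)"
proof -
  obtain T w where T: "finite T" "\<forall>u\<in>T. (0::real) < u"
    and w: "\<forall>q. degree q \<le> d \<longrightarrow> poly q 0 + (\<Sum>u\<in>T. w u * poly q u) = 0"
    and pos: "(\<Sum>u\<in>T. max (w u) 0) < (1/8 :: real)"
    using annihilating_measure_at_0[of d] by (elim exE conjE)
  \<comment> \<open>Inserting 1 makes the maximum well defined and positive.\<close>
  define M where "M = Max (insert 1 T)"
  have M: "0 < M" "\<And>u. u \<in> T \<Longrightarrow> u \<le> M"
  proof -
    have "u \<le> M" if "u \<in> insert 1 T" for u
      unfolding M_def using T(1) that by (intro Max_ge) auto
    then have "1 \<le> M" "\<And>u. u \<in> T \<Longrightarrow> u \<le> M" by blast+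
    then show "0 < M" "\<And>u. u \<in> T \<Longrightarrow> u \<le> M" by auto
  qed
  define g where "g u = 1 - u / M" for u
  have inj: "inj_on g T" using M(1) by (auto simp: g_def inj_on_def)
  have inv: "(1 - g u) * M = u" for u using M(1) by (simp add: g_def)
  have "poly q 1 + (\<Sum>\<theta>\<in>g ` T. w ((1 - \<theta>) * M) * poly q \<theta>) = 0" if "degree q \<le> d" for q
  proof -
    let ?q = "pcompose q [:1, - 1 / M:]"
    have "degree ?q \<le> d" using that M(1) by (simp add: degree_pcompose)
    from w[rule_format, OF this] have "poly q 1 + (\<Sum>u\<in>T. w u * poly q (g u)) = 0"
      by (simp add: poly_pcompose g_def)
    then show ?thesis by (simp add: sum.reindex[OF inj] inv)
  qed
  moreover have "(\<Sum>\<theta>\<in>g ` T. max (w ((1 - \<theta>) * M)) 0) < 1/8"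
    using pos by (simp add: sum.reindex[OF inj] inv)
  moreover have "g ` T \<subseteq> {0..<1}" using M T(2) by (auto simp: g_def)
  ultimately show ?thesis using T(1)
    by (intro exI[of _ "g ` T"] exI[of _ "\<lambda>\<theta>. w ((1 - \<theta>) * M)"]) auto
qed

section \<open>Biased bits and their correlations\<close>

definition bit_sign :: "nat set \<Rightarrow> nat \<Rightarrow> real" where
  "bit_sign r v = (if v \<in> r then - 1 else 1)"

text \<open>Toggling \<open>v\<close> is an involution of the power set under which the sum becomes
  its own negative.\<close>

lemma sum_Pow_flip:
  assumes "v < b" and flip: "\<And>r. f (sym_diff r {v}) = - (f r :: real)"
  shows "(\<Sum>r\<in>Pow {..<b}. f r) = 0"
proof -
  have "(\<Sum>r\<in>Pow {..<b}. f r) = (\<Sum>r\<in>Pow {..<b}. - f r)"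
    by (rule sum.reindex_bij_witness[of _ "\<lambda>r. sym_diff r {v}" "\<lambda>r. sym_diff r {v}"])
      (use assms in auto)
  then show ?thesis by (simp add: sum_negf)
qed

lemma sum_bit_sign: "v < b \<Longrightarrow> (\<Sum>r\<in>Pow {..<b}. bit_sign r v) = 0"
  by (rule sum_Pow_flip) (auto simp: bit_sign_def)

lemma sum_bit_sign_mult:
  assumes "v < b" "v' < b"
  shows "(\<Sum>r\<in>Pow {..<b}. bit_sign r v * bit_sign r v') = (if v = v' then 2 ^ b else 0)"
proof (cases "v = v'")
  case True
  have "bit_sign r v * bit_sign r v = 1" for r by (simp add: bit_sign_def)
  then show ?thesis using True by (simp add: card_Pow)
next
  case False
  then show ?thesis using sum_Pow_flip[OF assms(1), of "\<lambda>r. bit_sign r v * bit_sign r v'"]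
    by (auto simp: bit_sign_def)
qed

lemma sum_row_product:
  assumes "v < b" "v' < b"
  shows "(\<Sum>r\<in>Pow {..<b}. (1 + \<theta> * bit_sign r v) * (1 + \<theta>' * bit_sign r v'))
    = 2 ^ b * (if v = v' then 1 + \<theta> * \<theta>' else 1)"
proof -
  have "(\<Sum>r\<in>Pow {..<b}. (1 + \<theta> * bit_sign r v) * (1 + \<theta>' * bit_sign r v'))
     = (\<Sum>r\<in>Pow {..<b}. 1 + \<theta> * bit_sign r v + \<theta>' * bit_sign r v' + \<theta> * \<theta>' * (bit_sign r v * bit_sign r v'))"
    by (simp add: algebra_simps)
  also have "\<dots> = 2 ^ b + \<theta> * \<theta>' * (if v = v' then 2 ^ b else 0)"
    using assms by (simp add: sum.distrib card_Pow sum_bit_sign sum_bit_sign_mult flip: sum_distrib_left)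
  finally show ?thesis by (simp add: algebra_simps)
qed

text \<open>The density, relative to uniform bits, of independent selected bits with bias \<open>\<theta>\<close>.\<close>

definition density :: "nat \<Rightarrow> real \<Rightarrow> (nat \<Rightarrow> nat set) \<Rightarrow> (nat \<Rightarrow> nat) \<Rightarrow> real" where
  "density m \<theta> \<xi> V = (\<Prod>i<m. 1 + \<theta> * bit_sign (\<xi> i) (V i))"

definition agreement :: "nat \<Rightarrow> (nat \<Rightarrow> nat) \<Rightarrow> (nat \<Rightarrow> nat) \<Rightarrow> nat" where
  "agreement m V V' = card {i\<in>{..<m}. V i = V' i}"

lemma prod_agreement:
  "(\<Prod>i<m. if V i = V' i then c else (1::real)) = c ^ agreement m V V'"
  by (simp add: agreement_def prod.If_cases Int_def)

text \<open>The rows are independent, and within a row two selected bits correlate only if they are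
  the same bit.\<close>

lemma sum_density_product:
  assumes "V \<in> selectors m b" "V' \<in> selectors m b"
  shows "(\<Sum>\<xi>\<in>rows m b. density m \<theta> \<xi> V * density m \<theta>' \<xi> V')
    = (2 ^ b) ^ m * (1 + \<theta> * \<theta>') ^ agreement m V V'"
proof -
  have "(\<Sum>\<xi>\<in>rows m b. density m \<theta> \<xi> V * density m \<theta>' \<xi> V')
      = (\<Prod>i<m. \<Sum>r\<in>Pow {..<b}. (1 + \<theta> * bit_sign r (V i)) * (1 + \<theta>' * bit_sign r (V' i)))"
    by (subst prod_sum_PiE) (auto simp: density_def prod.distrib)
  also have "\<dots> = (\<Prod>i<m. 2 ^ b * (if V i = V' i then 1 + \<theta> * \<theta>' else 1))"
    using assms by (intro prod.cong refl sum_row_product) (auto simp: PiE_iff)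
  also have "\<dots> = (2 ^ b) ^ m * (1 + \<theta> * \<theta>') ^ agreement m V V'"
    by (simp add: prod.distrib prod_agreement)
  finally show ?thesis .
qed

lemma density_0 [simp]: "density m 0 \<xi> V = 1"
  by (simp add: density_def)

lemma sum_density:
  assumes "V \<in> selectors m b"
  shows "(\<Sum>\<xi>\<in>rows m b. density m \<theta> \<xi> V) = (2 ^ b) ^ m"
  using sum_density_product[OF assms assms, of \<theta> 0] by simp

lemma density_nonneg: "\<bar>\<theta>\<bar> \<le> 1 \<Longrightarrow> 0 \<le> density m \<theta> \<xi> V"
  unfolding density_def by (intro prod_nonneg) (auto simp: bit_sign_def)

lemma density_unfired: "\<not> fired m (\<xi>, V) \<Longrightarrow> density m \<theta> \<xi> V = (1 + \<theta>) ^ m"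
  by (simp add: density_def fired_def bit_sign_def)

text \<open>At bias 1 every selected bit is unset, so this density is a scaled indicator of not
  firing.\<close>

lemma density_1: "density m 1 \<xi> V = (if fired m (\<xi>, V) then 0 else 2 ^ m)"
proof (cases "fired m (\<xi>, V)")
  case True
  then show ?thesis by (auto simp: density_def fired_def bit_sign_def)
qed (simp add: density_unfired)

lemma card_rows: "card (rows m b) = (2 ^ b) ^ m"
  by (simp add: card_PiE card_Pow)

lemma card_selectors: "card (selectors m b) = b ^ m"
  by (simp add: card_PiE)

text \<open>In each row one column contributes \<open>b\<close> and each of the others 1, in total
  at most \<open>2b\<close>.\<close>

lemma sum_power_agreement:
  assumes "V \<in> selectors m b"
  shows "(\<Sum>V'\<in>selectors m b. real b ^ agreement m V V') \<le> (2 * real b) ^ m"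
proof -
  have "(\<Sum>V'\<in>selectors m b. real b ^ agreement m V V')
      = (\<Prod>i<m. \<Sum>v<b. if V i = v then real b else 1)"
    by (subst prod_sum_PiE) (auto simp: prod_agreement)
  also have "\<dots> \<le> (\<Prod>i<m. 2 * real b)"
  proof (intro prod_mono conjI sum_nonneg)
    fix i assume "i \<in> {..<m}"
    have "(\<Sum>v<b. if V i = v then real b else 1) \<le> (\<Sum>v<b. (if V i = v then real b else 0) + 1)"
      by (intro sum_mono) auto
    also have "\<dots> \<le> 2 * real b" by (simp add: sum.distrib)
    finally show "(\<Sum>v<b. if V i = v then real b else 1) \<le> 2 * real b" .
  qed auto
  finally show ?thesis by simp
qed

definition mixture :: "real set \<Rightarrow> (real \<Rightarrow> real) \<Rightarrow> nat \<Rightarrow> (nat \<Rightarrow> nat set) \<Rightarrow> (nat \<Rightarrow> nat) \<Rightarrow> real" where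
  "mixture T w m \<xi> V = (\<Sum>\<theta>\<in>T. w \<theta> * density m \<theta> \<xi> V)"

text \<open>Pairs that agree in at most \<open>d\<close> rows are uncorrelated because
  \<open>w\<close> annihilates degree \<open>d\<close>. For the other pairs
  \<open>b ^ agreement / b ^ d\<close> is at least 1, so a crude bound suffices.\<close>

lemma mixture_correlation:
  assumes T: "T \<subseteq> {0..1}" and b: "0 < b"
    and w: "\<And>q. degree q \<le> d \<Longrightarrow> (\<Sum>\<theta>\<in>T. w \<theta> * poly q \<theta>) = 0"
    and V: "V \<in> selectors m b" "V' \<in> selectors m b"
  shows "\<bar>\<Sum>\<xi>\<in>rows m b. mixture T w m \<xi> V * mixture T w m \<xi> V'\<bar>
    \<le> (2 ^ b) ^ m * (\<Sum>\<theta>\<in>T. \<bar>w \<theta>\<bar>)\<^sup>2 * 2 ^ m * (real b ^ agreement m V V' / real b ^ d)"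
proof -
  let ?a = "agreement m V V'"
  define K where "K = (\<Sum>\<theta>'\<in>T. w \<theta>' * (\<Sum>\<theta>\<in>T. w \<theta> * (1 + \<theta> * \<theta>') ^ ?a))"
  have "(\<Sum>\<xi>\<in>rows m b. mixture T w m \<xi> V * mixture T w m \<xi> V')
      = (\<Sum>\<xi>\<in>rows m b. \<Sum>\<theta>'\<in>T. \<Sum>\<theta>\<in>T. w \<theta>' * (w \<theta> * (density m \<theta> \<xi> V * density m \<theta>' \<xi> V')))"
    unfolding mixture_def sum_product by (subst sum.swap[of _ T T]) (simp add: mult_ac)
  also have "\<dots> = (\<Sum>\<theta>'\<in>T. \<Sum>\<theta>\<in>T. \<Sum>\<xi>\<in>rows m b. w \<theta>' * (w \<theta> * (density m \<theta> \<xi> V * density m \<theta>' \<xi> V')))"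
    by (subst sum.swap, intro sum.cong refl, rule sum.swap)
  also have "\<dots> = (\<Sum>\<theta>'\<in>T. \<Sum>\<theta>\<in>T. w \<theta>' * (w \<theta> * ((2 ^ b) ^ m * (1 + \<theta> * \<theta>') ^ ?a)))"
    by (simp only: sum_density_product[OF V] sum_distrib_left[symmetric])
  also have "\<dots> = (2 ^ b) ^ m * K"
    by (simp add: K_def sum_distrib_left mult_ac)
  finally have eq: "(\<Sum>\<xi>\<in>rows m b. mixture T w m \<xi> V * mixture T w m \<xi> V') = (2 ^ b) ^ m * K" .
  \<comment> \<open>The inner sum of \<open>K\<close> integrates a polynomial in \<open>\<theta>\<close> whose degree is the agreement.\<close>
  have K: "\<bar>K\<bar> \<le> (\<Sum>\<theta>\<in>T. \<bar>w \<theta>\<bar>)\<^sup>2 * 2 ^ m * (real b ^ ?a / real b ^ d)"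
  proof (cases "?a \<le> d")
    case True
    have "(\<Sum>\<theta>\<in>T. w \<theta> * (1 + \<theta> * \<theta>') ^ ?a) = 0" for \<theta>'
    proof -
      have "degree ([:1, \<theta>':] ^ ?a) \<le> degree [:1, \<theta>':] * ?a" by (rule degree_power_le)
      also have "\<dots> \<le> d" using True by (auto intro: order_trans)
      finally show ?thesis using w[of "[:1, \<theta>':] ^ ?a"] by (simp add: poly_power)
    qed
    then have "K = 0" by (simp add: K_def)
    then show ?thesis by simp
  next
    case False
    have am: "?a \<le> m"
      using card_mono[of "{..<m}" "{i\<in>{..<m}. V i = V' i}"] by (auto simp: agreement_def)
    have pow: "\<bar>(1 + \<theta> * \<theta>') ^ ?a\<bar> \<le> 2 ^ m" if "\<theta> \<in> T" "\<theta>' \<in> T" for \<theta> \<theta>'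
    proof -
      have "\<theta> \<in> {0..1}" "\<theta>' \<in> {0..1}" using that T by auto
      then have "0 \<le> \<theta> * \<theta>'" "\<theta> * \<theta>' \<le> 1" by (auto intro: mult_le_one)
      then have "\<bar>(1 + \<theta> * \<theta>') ^ ?a\<bar> \<le> 2 ^ ?a" by (auto simp: power_abs intro!: power_mono)
      also have "\<dots> \<le> 2 ^ m" using am by simp
      finally show ?thesis .
    qed
    have "\<bar>K\<bar> \<le> (\<Sum>\<theta>'\<in>T. \<bar>w \<theta>'\<bar> * (\<Sum>\<theta>\<in>T. \<bar>w \<theta>\<bar> * 2 ^ m))"
      unfolding K_def
    proof (rule order_trans[OF sum_abs], rule sum_mono)
      fix \<theta>' assume t: "\<theta>' \<in> T"
      have "\<bar>\<Sum>\<theta>\<in>T. w \<theta> * (1 + \<theta> * \<theta>') ^ ?a\<bar> \<le> (\<Sum>\<theta>\<in>T. \<bar>w \<theta>\<bar> * 2 ^ m)"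
        by (rule order_trans[OF sum_abs], rule sum_mono)
          (use pow[OF _ t] in \<open>auto simp: abs_mult intro!: mult_left_mono\<close>)
      then show "\<bar>w \<theta>' * (\<Sum>\<theta>\<in>T. w \<theta> * (1 + \<theta> * \<theta>') ^ ?a)\<bar> \<le> \<bar>w \<theta>'\<bar> * (\<Sum>\<theta>\<in>T. \<bar>w \<theta>\<bar> * 2 ^ m)"
        by (simp add: abs_mult mult_left_mono)
    qed
    also have "\<dots> = (\<Sum>\<theta>\<in>T. \<bar>w \<theta>\<bar>)\<^sup>2 * 2 ^ m * 1"
      by (simp add: power2_eq_square flip: sum_distrib_right)
    also have "\<dots> \<le> (\<Sum>\<theta>\<in>T. \<bar>w \<theta>\<bar>)\<^sup>2 * 2 ^ m * (real b ^ ?a / real b ^ d)"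
      using b False by (intro mult_left_mono) (auto simp: divide_simps intro: power_increasing)
    finally show ?thesis .
  qed
  show ?thesis
    unfolding eq using mult_left_mono[OF K, of "(2 ^ b) ^ m"] by (simp add: abs_mult mult_ac)
qed

text \<open>Cauchy-Schwarz over the rows reduces the claim to correlations of pairs of selectors.
  Degree \<open>2 * e\<close> is annihilated because the final square root halves the
  exponent.\<close>

lemma mixture_discrepancy:
  assumes T: "T \<subseteq> {0..1}" and b: "0 < b"
    and w: "\<And>q. degree q \<le> 2 * e \<Longrightarrow> (\<Sum>\<theta>\<in>T. w \<theta> * poly q \<theta>) = 0"
    and A: "A \<subseteq> rows m b" and B: "B \<subseteq> selectors m b"
  shows "\<bar>\<Sum>\<xi>\<in>A. \<Sum>V\<in>B. mixture T w m \<xi> V / ((2 ^ b) ^ m * real b ^ m)\<bar>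
    \<le> (\<Sum>\<theta>\<in>T. \<bar>w \<theta>\<bar>) * 2 ^ m / real b ^ e"
proof -
  let ?f = "mixture T w m" and ?L = "\<Sum>\<theta>\<in>T. \<bar>w \<theta>\<bar>" and ?M = "(2 ^ b) ^ m :: real"
  have fin: "finite (rows m b)" "finite (selectors m b)" by (auto intro!: finite_PiE)
  have "(\<Sum>\<xi>\<in>A. \<Sum>V\<in>B. ?f \<xi> V)\<^sup>2 \<le> real (card A) * (\<Sum>\<xi>\<in>A. (\<Sum>V\<in>B. ?f \<xi> V)\<^sup>2)"
    using Cauchy_Schwarz_ineq_sum[of "\<lambda>_. 1" "\<lambda>\<xi>. \<Sum>V\<in>B. ?f \<xi> V" A] by simp
  \<comment> \<open>The summands are squares, so \<open>A\<close> may be enlarged to all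
    rows.\<close>
  also have "\<dots> \<le> ?M * (\<Sum>\<xi>\<in>rows m b. (\<Sum>V\<in>B. ?f \<xi> V)\<^sup>2)"
  proof (intro mult_mono sum_mono2)
    have "real (card A) \<le> real (card (rows m b))" using A fin by (simp add: card_mono)
    then show "real (card A) \<le> ?M" by (simp add: card_rows)
  qed (use A fin in \<open>auto intro: sum_nonneg\<close>)
  also have "\<dots> \<le> ?M * (?M * ?L\<^sup>2 * 2 ^ m / real b ^ (2 * e) * (real b ^ m * (2 * real b) ^ m))"
  proof (rule mult_left_mono)
    have "(\<Sum>\<xi>\<in>rows m b. (\<Sum>V\<in>B. ?f \<xi> V)\<^sup>2) = (\<Sum>\<xi>\<in>rows m b. \<Sum>V\<in>B. \<Sum>V'\<in>B. ?f \<xi> V * ?f \<xi> V')"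
      by (simp add: power2_eq_square sum_product)
    also have "\<dots> = (\<Sum>V\<in>B. \<Sum>V'\<in>B. \<Sum>\<xi>\<in>rows m b. ?f \<xi> V * ?f \<xi> V')"
      by (subst sum.swap, intro sum.cong refl, rule sum.swap)
    also have "\<dots> \<le> (\<Sum>V\<in>B. \<Sum>V'\<in>B. ?M * ?L\<^sup>2 * 2 ^ m * (real b ^ agreement m V V' / real b ^ (2 * e)))"
      by (intro sum_mono, rule order_trans[OF abs_ge_self mixture_correlation[OF T b w]]) (use B in auto)
    also have "\<dots> = ?M * ?L\<^sup>2 * 2 ^ m / real b ^ (2 * e) * (\<Sum>V\<in>B. \<Sum>V'\<in>B. real b ^ agreement m V V')"
      by (simp add: sum_distrib_left)
    also have "\<dots> \<le> ?M * ?L\<^sup>2 * 2 ^ m / real b ^ (2 * e) * (real b ^ m * (2 * real b) ^ m)"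
    proof (rule mult_left_mono)
      have "(\<Sum>V\<in>B. \<Sum>V'\<in>B. real b ^ agreement m V V') \<le> (\<Sum>V\<in>B. (2 * real b) ^ m)"
      proof (rule sum_mono)
        fix V assume "V \<in> B"
        have "(\<Sum>V'\<in>B. real b ^ agreement m V V') \<le> (\<Sum>V'\<in>selectors m b. real b ^ agreement m V V')"
          using B fin by (intro sum_mono2) auto
        also have "\<dots> \<le> (2 * real b) ^ m" using \<open>V \<in> B\<close> B by (intro sum_power_agreement) auto
        finally show "(\<Sum>V'\<in>B. real b ^ agreement m V V') \<le> (2 * real b) ^ m" .
      qed
      also have "\<dots> = real (card B) * (2 * real b) ^ m" by simp
      also have "\<dots> \<le> real b ^ m * (2 * real b) ^ m"
      proof (rule mult_right_mono)
        have "real (card B) \<le> real (card (selectors m b))" using B fin by (simp add: card_mono)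
        then show "real (card B) \<le> real b ^ m" by (simp add: card_selectors)
      qed simp
      finally show "(\<Sum>V\<in>B. \<Sum>V'\<in>B. real b ^ agreement m V V') \<le> real b ^ m * (2 * real b) ^ m" .
    qed simp
    finally show "(\<Sum>\<xi>\<in>rows m b. (\<Sum>V\<in>B. ?f \<xi> V)\<^sup>2)
        \<le> ?M * ?L\<^sup>2 * 2 ^ m / real b ^ (2 * e) * (real b ^ m * (2 * real b) ^ m)" .
  qed simp
  also have "\<dots> = (?L * 2 ^ m / real b ^ e * (?M * real b ^ m))\<^sup>2"
  proof -
    have "M * (M * L\<^sup>2 * p / q\<^sup>2 * (r * (p * r))) = (L * p / q * (M * r))\<^sup>2" for M L p q r :: real
      by (simp add: power2_eq_square)
    then show ?thesis unfolding power_mult_distrib[of 2 "real b"] power_even_eq by simp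
  qed
  finally have sq: "(\<Sum>\<xi>\<in>A. \<Sum>V\<in>B. ?f \<xi> V)\<^sup>2 \<le> (?L * 2 ^ m / real b ^ e * (?M * real b ^ m))\<^sup>2" .
  have "0 \<le> ?L * 2 ^ m / real b ^ e * (?M * real b ^ m)"
    by (intro mult_nonneg_nonneg divide_nonneg_nonneg sum_nonneg) auto
  with sq have "\<bar>\<Sum>\<xi>\<in>A. \<Sum>V\<in>B. ?f \<xi> V\<bar> \<le> ?L * 2 ^ m / real b ^ e * (?M * real b ^ m)"
    by (simp only: power2_le_iff_abs_le)
  moreover have "0 < ?M * real b ^ m" using b by simp
  ultimately show ?thesis
    unfolding sum_divide_distrib[symmetric] abs_divide by (simp only: pos_divide_le_eq abs_of_pos)
qed

section \<open>The normalised gadget measure\<close>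

definition hard_measure ::
    "nat \<Rightarrow> nat \<Rightarrow> ((nat \<Rightarrow> nat set) \<times> (nat \<Rightarrow> nat) \<Rightarrow> real) \<Rightarrow> real \<Rightarrow> bool" where
  "hard_measure m b \<psi> \<delta> \<longleftrightarrow>
     (\<forall>z\<in>rows m b \<times> selectors m b. \<not> fired m z \<longrightarrow> 0 \<le> \<psi> z) \<and>
     (\<Sum>z | z \<in> rows m b \<times> selectors m b \<and> \<not> fired m z. \<psi> z) = 1 \<and>
     (\<Sum>z | z \<in> rows m b \<times> selectors m b \<and> fired m z. max (\<psi> z) 0) \<le> 1/4 \<and>
     (\<forall>A\<subseteq>rows m b. \<forall>B\<subseteq>selectors m b. \<bar>\<Sum>\<xi>\<in>A. \<Sum>V\<in>B. \<psi> (\<xi>, V)\<bar> \<le> \<delta>)"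

text \<open>Mix bias 1 with the annihilating weights on biases below 1. On fired inputs bias 1
  contributes nothing, so only the positive weights, of total below 1/8, can give positive mass.
  Both \<open>m\<close> and \<open>L\<close> depend on \<open>e\<close> alone, which leaves
  \<open>b\<close> free to grow.\<close>

lemma hard_measure_exists: "\<exists>m L. \<forall>b>0. \<exists>\<psi>. hard_measure m b \<psi> (L / real b ^ e)"
proof -
  obtain T w where T: "finite T" "T \<subseteq> {0..<1::real}"
    and w: "\<forall>q. degree q \<le> 2 * e \<longrightarrow> poly q 1 + (\<Sum>\<theta>\<in>T. w \<theta> * poly q \<theta>) = 0"
    and pos: "(\<Sum>\<theta>\<in>T. max (w \<theta>) 0) < (1/8 :: real)"
    using annihilating_measure_at_1[of "2 * e"] by (elim exE conjE)
  define T' where "T' = insert 1 T"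
  define w' where "w' = w(1 := 1)"
  have T': "T' \<subseteq> {0..1}" "finite T'" and 1: "1 \<notin> T" using T by (auto simp: T'_def)
  have sum_T': "(\<Sum>\<theta>\<in>T'. w' \<theta> * h \<theta>) = h 1 + (\<Sum>\<theta>\<in>T. w \<theta> * h \<theta>)" for h
  proof -
    have "(\<Sum>\<theta>\<in>T. w' \<theta> * h \<theta>) = (\<Sum>\<theta>\<in>T. w \<theta> * h \<theta>)"
      using 1 by (intro sum.cong) (auto simp: w'_def)
    then show ?thesis using 1 T by (simp add: T'_def w'_def)
  qed
  \<comment> \<open>With bias \<theta> a selected bit is unset with probability
    \<open>(1 + \<theta>) / 2\<close>, so this is the mass of the unfired inputs. It tends to 1,
    since only bias 1 survives as \<open>m\<close> grows.\<close>
  define \<rho> where "\<rho> m = (\<Sum>\<theta>\<in>T'. w' \<theta> * ((1 + \<theta>) / 2) ^ m)" for m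
  have "(\<lambda>m. 1 + (\<Sum>\<theta>\<in>T. w \<theta> * ((1 + \<theta>) / 2) ^ m)) \<longlonglongrightarrow> 1 + (\<Sum>\<theta>\<in>T. w \<theta> * 0)"
    by (intro tendsto_intros LIMSEQ_power_zero) (use T in auto)
  then have "eventually (\<lambda>m. 1/2 < 1 + (\<Sum>\<theta>\<in>T. w \<theta> * ((1 + \<theta>) / 2) ^ m)) sequentially"
    by (rule order_tendstoD) simp
  then obtain m where "1/2 < 1 + (\<Sum>\<theta>\<in>T. w \<theta> * ((1 + \<theta>) / 2) ^ m)"
    by (auto simp: eventually_sequentially)
  then have \<rho>: "1/2 < \<rho> m" by (simp add: \<rho>_def sum_T')
  define L where "L = (\<Sum>\<theta>\<in>T'. \<bar>w' \<theta>\<bar>) * 2 ^ m"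
  have L: "0 \<le> L" by (simp add: L_def sum_nonneg)
  show ?thesis
  \<comment> \<open>The factor 2 pays for dividing by \<open>\<rho> m > 1/2\<close>.\<close>
  proof (rule exI[of _ m], rule exI[of _ "2 * L"], intro allI impI)
    fix b :: nat assume b: "0 < b"
    let ?X = "rows m b" and ?Y = "selectors m b"
    let ?N = "(2 ^ b) ^ m * real b ^ m"
    have N: "0 < ?N" using b by simp
    have fin: "finite ?X" "finite ?Y" by (auto intro!: finite_PiE)
    define \<phi> where "\<phi> z = mixture T' w' m (fst z) (snd z) / ?N" for z
    define \<psi> where "\<psi> z = \<phi> z / \<rho> m" for z
    have sum_Z: "(\<Sum>z\<in>?X \<times> ?Y. h (fst z) (snd z)) = (\<Sum>V\<in>?Y. \<Sum>\<xi>\<in>?X. h \<xi> V)" for h :: "_ \<Rightarrow> _ \<Rightarrow> real"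
      by (subst sum.swap) (simp add: sum.cartesian_product case_prod_unfold)
    have unfired: "\<phi> z = \<rho> m * 2 ^ m / ?N" if "\<not> fired m z" for z
    proof -
      have "mixture T' w' m (fst z) (snd z) = (\<Sum>\<theta>\<in>T'. w' \<theta> * (1 + \<theta>) ^ m)"
        using that by (simp add: mixture_def density_unfired)
      also have "\<dots> = \<rho> m * 2 ^ m"
        by (simp add: \<rho>_def sum_distrib_right power_divide)
      finally show ?thesis by (simp add: \<phi>_def)
    qed
    show "\<exists>\<psi>. hard_measure m b \<psi> (2 * L / real b ^ e)"
      unfolding hard_measure_def
    proof (rule exI[of _ \<psi>], intro conjI allI impI ballI)
      fix z assume "\<not> fired m z"
      then show "0 \<le> \<psi> z" using \<rho> by (simp add: \<psi>_def unfired)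
    next
      have "(\<Sum>z | z \<in> ?X \<times> ?Y \<and> \<not> fired m z. \<phi> z)
          = (\<Sum>z\<in>?X \<times> ?Y. if \<not> fired m z then \<phi> z else 0)"
        using fin by (subst sum.inter_filter) auto
      \<comment> \<open>Writing the indicator of not firing as \<open>density m 1\<close> divided by
        \<open>2 ^ m\<close> makes the mass a correlation of densities.\<close>
      also have "\<dots> = (\<Sum>z\<in>?X \<times> ?Y. mixture T' w' m (fst z) (snd z) * density m 1 (fst z) (snd z) / (?N * 2 ^ m))"
        by (intro sum.cong) (auto simp: \<phi>_def density_1)
      also have "\<dots> = (\<Sum>V\<in>?Y. \<Sum>\<xi>\<in>?X. mixture T' w' m \<xi> V * density m 1 \<xi> V / (?N * 2 ^ m))"
        by (rule sum_Z)
      also have "\<dots> = (\<Sum>V\<in>?Y. \<rho> m / real b ^ m)"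
      proof (rule sum.cong)
        fix V assume V: "V \<in> ?Y"
        have ag: "agreement m V V = m" by (simp add: agreement_def)
        have "(\<Sum>\<xi>\<in>?X. mixture T' w' m \<xi> V * density m 1 \<xi> V / (?N * 2 ^ m))
            = (\<Sum>\<xi>\<in>?X. \<Sum>\<theta>\<in>T'. w' \<theta> * (density m \<theta> \<xi> V * density m 1 \<xi> V)) / (?N * 2 ^ m)"
          unfolding sum_divide_distrib[symmetric] mixture_def sum_distrib_right
          by (simp only: mult.assoc)
        also have "(\<Sum>\<xi>\<in>?X. \<Sum>\<theta>\<in>T'. w' \<theta> * (density m \<theta> \<xi> V * density m 1 \<xi> V))
            = (\<Sum>\<theta>\<in>T'. w' \<theta> * ((2 ^ b) ^ m * (1 + \<theta>) ^ m))"
          by (subst sum.swap) (simp add: sum_density_product[OF V V] ag flip: sum_distrib_left)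
        also have "\<dots> = \<rho> m * (2 ^ m * (2 ^ b) ^ m)"
          unfolding \<rho>_def sum_distrib_right by (intro sum.cong) (simp_all add: power_divide)
        finally show "(\<Sum>\<xi>\<in>?X. mixture T' w' m \<xi> V * density m 1 \<xi> V / (?N * 2 ^ m)) = \<rho> m / real b ^ m"
          by simp
      qed simp
      also have "\<dots> = \<rho> m" using b by (simp add: card_selectors)
      finally show "(\<Sum>z | z \<in> ?X \<times> ?Y \<and> \<not> fired m z. \<psi> z) = 1"
        using \<rho> by (simp add: \<psi>_def flip: sum_divide_distrib)
    next
      have "(\<Sum>z | z \<in> ?X \<times> ?Y \<and> fired m z. max (\<psi> z) 0)
          \<le> (\<Sum>z | z \<in> ?X \<times> ?Y \<and> fired m z. 2 * ((\<Sum>\<theta>\<in>T. max (w \<theta>) 0 * density m \<theta> (fst z) (snd z)) / ?N))"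
      proof (rule sum_mono)
        fix z assume "z \<in> {z. z \<in> ?X \<times> ?Y \<and> fired m z}"
        then have "density m 1 (fst z) (snd z) = 0" by (simp add: density_1)
        then have eq: "mixture T' w' m (fst z) (snd z) = (\<Sum>\<theta>\<in>T. w \<theta> * density m \<theta> (fst z) (snd z))"
          by (simp add: mixture_def sum_T')
        have nn: "0 \<le> density m \<theta> (fst z) (snd z)" if "\<theta> \<in> T" for \<theta>
          using T that by (intro density_nonneg) auto
        define P where "P = (\<Sum>\<theta>\<in>T. max (w \<theta>) 0 * density m \<theta> (fst z) (snd z)) / ?N"
        have P: "0 \<le> P" unfolding P_def using nn N by (intro divide_nonneg_nonneg sum_nonneg mult_nonneg_nonneg) auto
        have "\<phi> z \<le> P"
          unfolding \<phi>_def P_def eq using nn N by (intro divide_right_mono sum_mono mult_right_mono) auto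
        then have "\<psi> z \<le> P / \<rho> m" using \<rho> by (simp add: \<psi>_def divide_right_mono)
        also have "\<dots> \<le> P / (1/2)" using \<rho> P by (intro divide_left_mono) auto
        finally show "max (\<psi> z) 0 \<le> 2 * P" using P by simp
      qed
      also have "\<dots> \<le> (\<Sum>z\<in>?X \<times> ?Y. 2 * ((\<Sum>\<theta>\<in>T. max (w \<theta>) 0 * density m \<theta> (fst z) (snd z)) / ?N))"
      proof (rule sum_mono2)
        fix z
        have "0 \<le> density m \<theta> (fst z) (snd z)" if "\<theta> \<in> T" for \<theta>
          using T that by (intro density_nonneg) auto
        then show "0 \<le> 2 * ((\<Sum>\<theta>\<in>T. max (w \<theta>) 0 * density m \<theta> (fst z) (snd z)) / ?N)"
          using N by (intro mult_nonneg_nonneg divide_nonneg_nonneg sum_nonneg) auto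
      qed (use fin in auto)
      also have "\<dots> = 2 * ((\<Sum>V\<in>?Y. \<Sum>\<xi>\<in>?X. \<Sum>\<theta>\<in>T. max (w \<theta>) 0 * density m \<theta> \<xi> V) / ?N)"
        by (subst sum_Z) (simp add: sum_distrib_left sum_divide_distrib)
      also have "(\<Sum>V\<in>?Y. \<Sum>\<xi>\<in>?X. \<Sum>\<theta>\<in>T. max (w \<theta>) 0 * density m \<theta> \<xi> V)
          = (\<Sum>V\<in>?Y. \<Sum>\<theta>\<in>T. max (w \<theta>) 0 * (2 ^ b) ^ m)"
        by (intro sum.cong refl, subst sum.swap) (simp add: sum_density flip: sum_distrib_left)
      also have "\<dots> = (\<Sum>\<theta>\<in>T. max (w \<theta>) 0) * ?N"
        by (simp add: card_selectors flip: sum_distrib_right)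
      also have "2 * ((\<Sum>\<theta>\<in>T. max (w \<theta>) 0) * ?N / ?N) \<le> 1/4"
        using N pos by simp
      finally show "(\<Sum>z | z \<in> ?X \<times> ?Y \<and> fired m z. max (\<psi> z) 0) \<le> 1/4" .
    next
      fix A B assume AB: "A \<subseteq> ?X" "B \<subseteq> ?Y"
      have "\<bar>\<Sum>\<xi>\<in>A. \<Sum>V\<in>B. \<phi> (\<xi>, V)\<bar> \<le> L / real b ^ e"
        using mixture_discrepancy[OF T'(1) b _ AB, of e w'] w by (simp add: \<phi>_def L_def sum_T')
      moreover have "(\<Sum>\<xi>\<in>A. \<Sum>V\<in>B. \<psi> (\<xi>, V)) = (\<Sum>\<xi>\<in>A. \<Sum>V\<in>B. \<phi> (\<xi>, V)) / \<rho> m"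
        by (simp add: \<psi>_def flip: sum_divide_distrib)
      moreover have "\<bar>x / \<rho> m\<bar> = \<bar>x\<bar> / \<rho> m" for x using \<rho> by (simp add: abs_divide)
      ultimately have "\<bar>\<Sum>\<xi>\<in>A. \<Sum>V\<in>B. \<psi> (\<xi>, V)\<bar> \<le> L / real b ^ e / \<rho> m"
        using \<rho> by (simp only: divide_right_mono)
      also have "\<dots> \<le> L / real b ^ e / (1/2)"
        using \<rho> L by (intro divide_left_mono) auto
      finally show "\<bar>\<Sum>\<xi>\<in>A. \<Sum>V\<in>B. \<psi> (\<xi>, V)\<bar> \<le> 2 * L / real b ^ e" by (simp add: mult.commute)
    qed
  qed
qed

subsection \<open>The lower bound\<close>

text \<open>Only one level varies. Each run of a block repeats a constant or a bit of one player,
  and the other levels are constant.\<close>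

lemma separated_word:
  "separated (\<lambda>\<xi> V. word m b c (s @ (\<xi>, V) # t))"
proof -
  have "separated (\<lambda>\<xi> V. level_word m b d (\<xi>, V))" for d
    unfolding level_word_def
  proof (rule separated_concat)
    fix ij :: "nat \<times> nat"
    show "separated (\<lambda>\<xi> V. case ij of (i, j) \<Rightarrow> block d (j \<in> fst (\<xi>, V) i) (snd (\<xi>, V) i = j))"
      unfolding block_def case_prod_unfold fst_conv snd_conv
      by (intro separated_append separated_const separated_replicate_left separated_replicate_right)
  qed
  then show ?thesis
    unfolding word_append word.simps
    by (intro separated_append separated_const)
qed

lemma nat_poly_bound: "\<exists>C k. \<forall>n. poly (p :: nat poly) n \<le> C * (n + 1) ^ k"
proof (induction p)
  case (pCons a p)
  then obtain C k where IH: "\<And>n. poly p n \<le> C * (n + 1) ^ k" by blast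
  have "poly (pCons a p) n \<le> (a + C) * (n + 1) ^ Suc k" for n
  proof -
    have "a * 1 \<le> a * (n + 1) ^ Suc k" by (intro mult_left_mono one_le_power) auto
    moreover have "n * poly p n \<le> (n + 1) * (C * (n + 1) ^ k)"
      using IH by (intro mult_mono) auto
    ultimately have "a * 1 + n * poly p n \<le> a * (n + 1) ^ Suc k + (n + 1) * (C * (n + 1) ^ k)"
      by (rule add_mono)
    then show ?thesis by (simp add: algebra_simps)
  qed
  then show ?case by blast
qed (auto intro: exI[of _ 0])

text \<open>\<open>n\<close> is the length of a word with \<open>b\<close> levels. The value of the
  circuit on such words has the signs that amplification requires, and its rectangle weight bounds
  both its correlation with \<psi> and its size.\<close>

lemma walk_parity_weight_bound:
  fixes m b :: nat
  defines "n \<equiv> 6 * m * b * (\<Sum>i<b. Suc i)"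
  assumes t: "bounded_gate (length gs) B t" and gs: "\<forall>g\<in>set gs. bounded_gate (2 * n + 2) B g"
    and f: "\<forall>x\<in>cube n. walk_parity x \<longleftrightarrow> depth2_output t gs x"
    and W: "2 * (real (length gs) * (real B * (2 * real ((2 * n + 2) * B) + 1))) + (2 * real B + 1) \<le> W"
    and hard: "hard_measure m b \<psi> \<delta>"
    and small: "W * \<delta> < 1/2"
  shows "2 ^ b \<le> W"
proof -
  note nonneg = hard[unfolded hard_measure_def, THEN conjunct1]
    and one = hard[unfolded hard_measure_def, THEN conjunct2, THEN conjunct1]
    and pos = hard[unfolded hard_measure_def, THEN conjunct2, THEN conjunct2, THEN conjunct1]
    and disc = hard[unfolded hard_measure_def, THEN conjunct2, THEN conjunct2, THEN conjunct2]
  let ?Z = "rows m b \<times> selectors m b"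
  define Z0 where "Z0 = {z. z \<in> ?Z \<and> \<not> fired m z}"
  have diff: "?Z - Z0 = {z. z \<in> ?Z \<and> fired m z}" by (auto simp: Z0_def)
  have fin: "finite (rows m b)" "finite (selectors m b)" by (auto intro!: finite_PiE)
  define H where "H s = depth2_value t gs (word m b 0 s)" for s
  have len: "length (word m b 0 s) = n" if "length s = b" for s
    using that by (simp add: length_word n_def)
  have "\<exists>s. length s = b \<and> set s \<subseteq> ?Z \<and> 2 ^ b \<le> \<bar>H s\<bar>"
  proof (rule sign_amplification[OF _ _ _ _ _ _ _ small])
    show "finite ?Z" using fin by simp
    show "Z0 \<subseteq> ?Z" by (auto simp: Z0_def)
    show "0 \<le> \<psi> z" if "z \<in> Z0" for z using nonneg that by (auto simp: Z0_def)
    show "sum \<psi> Z0 = 1" using one by (simp add: Z0_def)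
    show "(\<Sum>z\<in>?Z - Z0. max (\<psi> z) 0) \<le> 1/4" using pos unfolding diff .
  next
    fix s t' :: "((nat \<Rightarrow> nat set) \<times> (nat \<Rightarrow> nat)) list"
    assume st: "length s + length t' = b" "set s \<subseteq> ?Z" "set t' \<subseteq> Z0" "s = [] \<or> last s \<in> ?Z - Z0"
    have "walk_parity (word m b 0 (s @ t')) \<longleftrightarrow> even (length s)"
      by (rule walk_parity_word) (use st in \<open>force simp: Z0_def\<close>)+
    moreover have "word m b 0 (s @ t') \<in> cube n" using st by (simp add: cube_def len)
    ultimately have "depth2_output t gs (word m b 0 (s @ t')) \<longleftrightarrow> even (length s)"
      using f by blast
    then show "1 \<le> (- 1) ^ length s * H (s @ t')"
      using depth2_value_sign[of t gs "word m b 0 (s @ t')"] by (auto simp: H_def split: if_splits)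
  next
    fix s t' :: "((nat \<Rightarrow> nat set) \<times> (nat \<Rightarrow> nat)) list"
    assume st: "length s + length t' + 1 = b"
    have "rect_bound W (\<lambda>\<xi> V. H (s @ (\<xi>, V) # t'))"
      unfolding H_def using st
      by (intro rect_bound_mono[OF rect_bound_depth2[OF separated_word _ t gs] W] len) auto
    then have "\<bar>\<Sum>\<xi>\<in>rows m b. \<Sum>V\<in>selectors m b. \<psi> (\<xi>, V) * H (s @ (\<xi>, V) # t')\<bar> \<le> W * \<delta>"
      by (rule rect_boundD[OF _ fin]) (use disc in simp)
    then show "\<bar>\<Sum>z\<in>?Z. \<psi> z * H (s @ z # t')\<bar> \<le> W * \<delta>"
      by (simp add: sum.cartesian_product case_prod_unfold)
  qed
  then obtain s where s: "length s = b" "2 ^ b \<le> \<bar>H s\<bar>" by blast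
  \<comment> \<open>A fixed word is a separated word over one-point input sets, which bounds the
    single value \<open>H s\<close>.\<close>
  have "rect_bound W (\<lambda>(_ :: unit) (_ :: unit). H s)"
    unfolding H_def using s
    by (intro rect_bound_mono[OF rect_bound_depth2[OF separated_const _ t gs] W] len)
  then have "\<bar>H s\<bar> \<le> W" by (rule rect_bound_value)
  then show ?thesis using s by simp
qed

lemma walk_parity_not_MAJ_MAJ: "walk_parity \<notin> MAJ_MAJ"
proof
  assume "walk_parity \<in> MAJ_MAJ"
  then obtain sp bp :: "nat poly" where circ: "\<And>n. \<exists>t gs.
     Suc (length gs) \<le> poly sp n \<and> bounded_gate (length gs) (poly bp n) t \<and>
     (\<forall>g\<in>set gs. bounded_gate (2 * n + 2) (poly bp n) g) \<and>
     (\<forall>x\<in>cube n. walk_parity x \<longleftrightarrow> depth2_output t gs x)"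
    unfolding MAJ_MAJ_def by blast
  \<comment> \<open>This is the weight bound for depth-two circuits as a polynomial in
    \<open>n\<close>; \<open>[:2, 2:]\<close> counts the bottom inputs.\<close>
  define wp where "wp = [:2:] * (sp * (bp * ([:2:] * ([:2, 2:] * bp) + 1))) + ([:2:] * bp + 1)"
  obtain C k where C: "\<And>n. poly wp n \<le> C * (n + 1) ^ k" using nat_poly_bound by blast
  \<comment> \<open>As \<open>n + 1\<close> is at most a constant times \<open>b ^ 3\<close>, the
    weight is at most \<open>K * b ^ (3 * k)\<close>. One further power of \<open>b\<close> in the
    discrepancy makes their product tend to 0.\<close>
  obtain m L where gadget: "\<And>b. 0 < b \<Longrightarrow> \<exists>\<psi>. hard_measure m b \<psi> (L / real b ^ Suc (3 * k))"
    using hard_measure_exists[of "Suc (3 * k)"] by blast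
  define K where "K = real C * (6 * real m + 1) ^ k"
  have "eventually (\<lambda>b. K * real b ^ (3 * k) < 2 ^ b \<and> K * L / real b < 1/2 \<and> 0 < b) sequentially"
  proof (intro eventually_conj)
    show "eventually (\<lambda>b. K * real b ^ (3 * k) < 2 ^ b) sequentially"
      by real_asymp
    have "((\<lambda>b. K * L / real b) \<longlongrightarrow> 0) sequentially" by real_asymp
    then show "eventually (\<lambda>b. K * L / real b < 1/2) sequentially"
      by (rule order_tendstoD) simp
  qed (rule eventually_gt_at_top)
  then obtain b where b: "K * real b ^ (3 * k) < 2 ^ b" "K * L / real b < 1/2" "0 < b"
    by (auto simp: eventually_sequentially)
  define W where "W = K * real b ^ (3 * k)"
  define n where "n = 6 * m * b * (\<Sum>i<b. Suc i)"
  have "(\<Sum>i<b. Suc i) \<le> (\<Sum>i<b. b)" by (intro sum_mono) auto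
  then have "n \<le> 6 * m * b * (b * b)" by (simp add: n_def)
  \<comment> \<open>This absorbs the 1 of \<open>n + 1\<close> into the cubic bound.\<close>
  moreover have "1 \<le> b * b * b" using b by simp
  ultimately have "n + 1 \<le> 6 * m * b * (b * b) + b * b * b" by linarith
  also have "\<dots> = (6 * m + 1) * b ^ 3" by (simp add: power3_eq_cube algebra_simps)
  finally have "n + 1 \<le> (6 * m + 1) * b ^ 3" .
  then have "C * (n + 1) ^ k \<le> C * ((6 * m + 1) * b ^ 3) ^ k"
    by (intro mult_left_mono power_mono) auto
  with C[of n] have "poly wp n \<le> C * ((6 * m + 1) * b ^ 3) ^ k" by (rule order_trans)
  then have "real (poly wp n) \<le> real (C * ((6 * m + 1) * b ^ 3) ^ k)" by (simp only: of_nat_le_iff)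
  also have "\<dots> = W" unfolding W_def K_def
    by (simp only: of_nat_mult of_nat_power of_nat_add of_nat_numeral of_nat_1 power_mult_distrib power_mult mult.assoc)
  finally have wp: "real (poly wp n) \<le> W" .
  from circ[of n] obtain t gs where t: "Suc (length gs) \<le> poly sp n"
    "bounded_gate (length gs) (poly bp n) t" "\<forall>g\<in>set gs. bounded_gate (2 * n + 2) (poly bp n) g"
    "\<forall>x\<in>cube n. walk_parity x \<longleftrightarrow> depth2_output t gs x" by blast
  let ?B = "poly bp n"
  have "2 * (length gs * (?B * (2 * ((2 * n + 2) * ?B) + 1))) + (2 * ?B + 1) \<le> poly wp n"
  proof -
    have "length gs \<le> poly sp n" using t(1) by simp
    moreover have "poly wp n = 2 * (poly sp n * (?B * (2 * ((2 * n + 2) * ?B) + 1))) + (2 * ?B + 1)"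
      by (simp add: wp_def algebra_simps)
    ultimately show ?thesis by simp
  qed
  then have "real (2 * (length gs * (?B * (2 * ((2 * n + 2) * ?B) + 1))) + (2 * ?B + 1)) \<le> W"
    using wp by linarith
  then have bound: "2 * (real (length gs) * (real ?B * (2 * real ((2 * n + 2) * ?B) + 1))) + (2 * real ?B + 1) \<le> W"
    by (simp only: of_nat_mult of_nat_add of_nat_numeral of_nat_1)
  have small: "W * (L / real b ^ Suc (3 * k)) < 1/2"
    using b by (simp add: W_def)
  from gadget[OF b(3)] obtain \<psi> where "hard_measure m b \<psi> (L / real b ^ Suc (3 * k))" by blast
  from walk_parity_weight_bound[OF t(2-4)[unfolded n_def] bound[unfolded n_def] this small]
  show False using b(1) by (simp add: W_def)
qed

theorem theorem2:
  "\<not> HNN \<subseteq> MAJ_MAJ \<and>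
   (\<exists>f :: bool_family.
      (\<forall>n. \<exists>P N. HNN_rep n f P N \<and> card (P \<union> N) = n + 1) \<and>
      f \<notin> MAJ_MAJ)"
proof -
  have "\<exists>P N. HNN_rep n walk_parity P N \<and> card (P \<union> N) \<le> poly [:1, 1:] n" for n
  proof -
    obtain P N where "HNN_rep n walk_parity P N" "card (P \<union> N) = n + 1"
      using HNN_rep_walk_parity[of n] by blast
    then show ?thesis by (intro exI[of _ P] exI[of _ N]) simp
  qed
  then have "walk_parity \<in> HNN"
    unfolding HNN_def by blast
  then show ?thesis
    using HNN_rep_walk_parity walk_parity_not_MAJ_MAJ by blast
qed

end
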